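(* Let $G$ be a finitely generated group and let $H_1,\dots,H_l$ be stable subgroups of $G$. Then the collection $\mathcal{H}=\{H_1,\dots,H_l\}$ satisfies the following: (1) $\mathcal{H}$ has finite height; (2) $\mathcal{H}$ has finite width; (3) $\mathcal{H}$ has bounded packing in $G$.
   Context: Stability. Let $X$ be a geodesic metric space and $f\colon \mathbb{R}_{\ge 1}\times\mathbb{R}_{\ge 0}\to\mathbb{R}_{\ge 0}$ a function. A quasigeodesic $\gamma$ in $X$ is $f$-stable if every $(K,\epsilon)$-quasigeodesic $\eta$ with endpoints on $\gamma$ is contained in the $f(K,\epsilon)$-neighborhood of $\gamma$. A quasi-isometric embedding $\Phi\colon X\to Y$ of geodesic metric spaces is a stable embedding if there is a single function $f$ such that the image of every geodesic of $X$ is an $f$-stable quasigeodesic in $Y$. If $H\le G$ are finitely generated groups (viewed via Cayley graphs with respect to finite generating sets), $H$ is a stable subgroup of $G$ if the inclusion $H\to G$ is a stable embedding. Write $H^g=gHg^{-1}$. For a finite collection $\mathcal{H}=\{H_1,\dots,H_l\}$ of subgroups of $G$, conjugates $H_{\sigma(1)}^{g_1},\dots,H_{\sigma(k)}^{g_k}$ are essentially distinct if the cosets $g_1H_{\sigma(1)},\dots,g_kH_{\sigma(k)}$ are distinct. $\mathcal{H}$ has height at most $n$ if the intersection of any $n+1$ essentially distinct conjugates of members of $\mathcal{H}$ is finite; it has finite height if this holds for some $n$. The width of $\mathcal{H}$ is the maximal cardinality of a collection of distinct cosets $\{g_iH_{\sigma(i)}\}$ such that $|H_{\sigma(i)}^{g_i}\cap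 H_{\sigma(j)}^{g_j}|=\infty$ for all $i,j$; finite width means this is finite. $\mathcal{H}$ has bounded packing in $G$ if, for every $D\ge 0$ (with respect to a word metric of a finite generating set), there is $N\in\mathbb{N}$ such that in any collection of $N$ distinct left cosets $gH_i$ with $H_i\in\mathcal{H}$, at least two are at (minimum) distance at least $D$ from each other. *)

theory Defs
  imports "HOL-Analysis.Analysis" "HOL-Algebra.Generated_Groups"
begin

section \<open>Coarse geometry\<close>

definition qi_embedding ::
  "real \<Rightarrow> real \<Rightarrow> 'a metric \<Rightarrow> 'b metric \<Rightarrow> ('a \<Rightarrow> 'b) \<Rightarrow> bool" where
  "qi_embedding K \<epsilon> X Y \<Phi> \<longleftrightarrow> 1 \<le> K \<and> 0 \<le> \<epsilon> \<and> \<Phi> \<in> mspace X \<rightarrow> mspace Y \<and>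
     (\<forall>x\<in>mspace X. \<forall>y\<in>mspace X.
        mdist X x y / K - \<epsilon> \<le> mdist Y (\<Phi> x) (\<Phi> y) \<and>
        mdist Y (\<Phi> x) (\<Phi> y) \<le> K * mdist X x y + \<epsilon>)"

text \<open>Geodesics and quasigeodesics are parametrized by compact intervals, and quasigeodesics are not
  required to be continuous. Stability for geodesic rays and lines, with the same gauge, follows
  by restriction to compact subintervals.\<close>

definition quasigeodesic ::
  "'a metric \<Rightarrow> real \<Rightarrow> real \<Rightarrow> real \<Rightarrow> real \<Rightarrow> (real \<Rightarrow> 'a) \<Rightarrow> bool" where
  "quasigeodesic X K \<epsilon> a b \<gamma> \<longleftrightarrow>
     a \<le> b \<and> qi_embedding K \<epsilon> (submetric euclidean_metric {a..b}) X \<gamma>"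

definition geodesic :: "'a metric \<Rightarrow> real \<Rightarrow> real \<Rightarrow> (real \<Rightarrow> 'a) \<Rightarrow> bool" where
  "geodesic X a b \<gamma> \<longleftrightarrow> a \<le> b \<and> \<gamma> \<in> {a..b} \<rightarrow> mspace X \<and>
     (\<forall>s\<in>{a..b}. \<forall>t\<in>{a..b}. mdist X (\<gamma> s) (\<gamma> t) = \<bar>s - t\<bar>)"

definition geodesic_space :: "'a metric \<Rightarrow> bool" where
  "geodesic_space X \<longleftrightarrow> (\<forall>p\<in>mspace X. \<forall>q\<in>mspace X.
     \<exists>a b \<gamma>. geodesic X a b \<gamma> \<and> \<gamma> a = p \<and> \<gamma> b = q)"

text \<open>The gauge \<open>f\<close> is only evaluated at \<open>K \<ge> 1\<close>, \<open>\<epsilon> \<ge> 0\<close>, since these bounds are part of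
  \<open>quasigeodesic\<close>.\<close>

definition stable_quasigeodesic ::
  "(real \<Rightarrow> real \<Rightarrow> real) \<Rightarrow> 'a metric \<Rightarrow> real \<Rightarrow> real \<Rightarrow> (real \<Rightarrow> 'a) \<Rightarrow> bool" where
  "stable_quasigeodesic f X a b \<gamma> \<longleftrightarrow>
     (\<exists>K \<epsilon>. quasigeodesic X K \<epsilon> a b \<gamma>) \<and>
     (\<forall>K \<epsilon> c d \<eta>. quasigeodesic X K \<epsilon> c d \<eta> \<and> \<eta> c \<in> \<gamma> ` {a..b} \<and> \<eta> d \<in> \<gamma> ` {a..b} \<longrightarrow>
        (\<forall>t\<in>{c..d}. \<exists>s\<in>{a..b}. mdist X (\<eta> t) (\<gamma> s) \<le> f K \<epsilon>))"

definition stable_embedding :: "'a metric \<Rightarrow> 'b metric \<Rightarrow> ('a \<Rightarrow> 'b) \<Rightarrow> bool" where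
  "stable_embedding X Y \<Phi> \<longleftrightarrow>
     (\<exists>K \<epsilon>. qi_embedding K \<epsilon> X Y \<Phi>) \<and>
     (\<exists>f. (\<forall>K\<ge>1. \<forall>\<epsilon>\<ge>0. 0 \<le> f K \<epsilon>) \<and>
        (\<forall>a b \<gamma>. geodesic X a b \<gamma> \<longrightarrow> stable_quasigeodesic f Y a b (\<Phi> \<circ> \<gamma>)))"

section \<open>Geometric realization of a graph\<close>

text \<open>A graph is given by its vertex set \<open>V\<close> and a symmetric relation \<open>E\<close> on \<open>V\<close>. Points of the
  realization are given by barycentric coordinates supported on a vertex or on an edge. Hence
  parallel edges are identified and loops are collapsed to their base vertex.\<close>

definition supp :: "('a \<Rightarrow> real) \<Rightarrow> 'a set" where
  "supp p = {v. p v \<noteq> 0}"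

definition graph_points :: "'a set \<Rightarrow> ('a \<times> 'a) set \<Rightarrow> ('a \<Rightarrow> real) set" where
  "graph_points V E = {p. (\<forall>v. 0 \<le> p v) \<and>
     (\<exists>u\<in>V. \<exists>v\<in>V. (u = v \<or> (u, v) \<in> E) \<and> supp p \<subseteq> {u, v} \<and> sum p {u, v} = 1)}"

definition vertex :: "'a \<Rightarrow> 'a \<Rightarrow> real" where
  "vertex v = indicator {v}"

definition graph_dist :: "('a \<times> 'a) set \<Rightarrow> 'a \<Rightarrow> 'a \<Rightarrow> nat" where
  "graph_dist E u v = (LEAST n. (u, v) \<in> E ^^ n)"

definition same_edge :: "('a \<times> 'a) set \<Rightarrow> ('a \<Rightarrow> real) \<Rightarrow> ('a \<Rightarrow> real) \<Rightarrow> bool" where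
  "same_edge E p q \<longleftrightarrow> (\<exists>u v. (u = v \<or> (u, v) \<in> E) \<and> supp p \<union> supp q \<subseteq> {u, v})"

text \<open>The path metric with all edges of length \<open>1\<close>. Within an edge \<open>{u, v}\<close> the half sum below is
  \<open>\<bar>p u - q u\<bar>\<close>; otherwise a shortest path leaves \<open>p\<close> through an endpoint \<open>u\<close> of its edge (at
  distance \<open>1 - p u\<close>) and reaches \<open>q\<close> through an endpoint \<open>v\<close> of its edge. The value is \<open>0\<close> off
  the realization because \<open>Metric_space\<close> asks for nonnegativity and symmetry everywhere.\<close>

definition graph_points_dist ::
  "'a set \<Rightarrow> ('a \<times> 'a) set \<Rightarrow> ('a \<Rightarrow> real) \<Rightarrow> ('a \<Rightarrow> real) \<Rightarrow> real" where
  "graph_points_dist V E p q =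
     (if p \<notin> graph_points V E \<or> q \<notin> graph_points V E then 0
      else if same_edge E p q then (\<Sum>x\<in>supp p \<union> supp q. \<bar>p x - q x\<bar>) / 2
      else Min ((\<lambda>(u, v). (1 - p u) + real (graph_dist E u v) + (1 - q v)) ` (supp p \<times> supp q)))"

definition graph_space :: "'a set \<Rightarrow> ('a \<times> 'a) set \<Rightarrow> ('a \<Rightarrow> real) metric" where
  "graph_space V E = metric (graph_points V E, graph_points_dist V E)"

section \<open>Cayley graphs\<close>

definition finite_generating_set :: "('a, 'b) monoid_scheme \<Rightarrow> 'a set \<Rightarrow> bool" where
  "finite_generating_set G S \<longleftrightarrow> finite S \<and> S \<subseteq> carrier G \<and> generate G S = carrier G"

definition finitely_generated :: "('a, 'b) monoid_scheme \<Rightarrow> bool" where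
  "finitely_generated G \<longleftrightarrow> (\<exists>S. finite_generating_set G S)"

definition cayley_edges :: "('a, 'b) monoid_scheme \<Rightarrow> 'a set \<Rightarrow> ('a \<times> 'a) set" where
  "cayley_edges G S = {(g, g \<otimes>\<^bsub>G\<^esub> s) | g s. g \<in> carrier G \<and> s \<in> S \<union> m_inv G ` S}"

definition cayley_space :: "('a, 'b) monoid_scheme \<Rightarrow> 'a set \<Rightarrow> ('a \<Rightarrow> real) metric" where
  "cayley_space G S = graph_space (carrier G) (cayley_edges G S)"

text \<open>A path of length \<open>n\<close> from \<open>g\<close> to \<open>h\<close> in the Cayley graph spells a word of length \<open>n\<close> over
  \<open>S\<close> and its inverses that represents \<open>g\<inverse>h\<close>.\<close>

definition word_metric :: "('a, 'b) monoid_scheme \<Rightarrow> 'a set \<Rightarrow> 'a \<Rightarrow> 'a \<Rightarrow> nat" where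
  "word_metric G S = graph_dist (cayley_edges G S)"

text \<open>The inclusion of \<open>H\<close> is only prescribed on vertices; \<open>\<Phi>\<close> extends it to the edges of the
  Cayley graph of \<open>H\<close>. Any two quasi-isometric embeddings that agree on the vertices are at bounded
  distance, so neither the choice of \<open>\<Phi>\<close> nor that of the generating sets matters.\<close>

definition stable_subgroup :: "('a, 'b) monoid_scheme \<Rightarrow> 'a set \<Rightarrow> bool" where
  "stable_subgroup G H \<longleftrightarrow> subgroup H G \<and>
     (\<exists>S T \<Phi>. finite_generating_set G S \<and> finite_generating_set (G\<lparr>carrier := H\<rparr>) T \<and>
        (\<forall>h\<in>H. \<Phi> (vertex h) = vertex h) \<and>
        stable_embedding (cayley_space (G\<lparr>carrier := H\<rparr>) T) (cayley_space G S) \<Phi>)"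

section \<open>Height, width and bounded packing\<close>

definition conjugate :: "('a, 'b) monoid_scheme \<Rightarrow> 'a set \<Rightarrow> 'a \<Rightarrow> 'a set" where
  "conjugate G H g = (g <#\<^bsub>G\<^esub> H) #>\<^bsub>G\<^esub> inv\<^bsub>G\<^esub> g"

text \<open>The \<open>i\<close>-th coset is \<open>g i <# K i\<close> for \<open>i < k\<close>. For subgroups, distinctness of the cosets is
  distinctness as subsets of the group.\<close>

definition distinct_cosets ::
  "('a, 'b) monoid_scheme \<Rightarrow> 'a set set \<Rightarrow> nat \<Rightarrow> (nat \<Rightarrow> 'a) \<Rightarrow> (nat \<Rightarrow> 'a set) \<Rightarrow> bool" where
  "distinct_cosets G \<H> k g K \<longleftrightarrow>
     (\<forall>i<k. g i \<in> carrier G \<and> K i \<in> \<H>) \<and> inj_on (\<lambda>i. g i <#\<^bsub>G\<^esub> K i) {..<k}"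

definition height_at_most :: "('a, 'b) monoid_scheme \<Rightarrow> 'a set set \<Rightarrow> nat \<Rightarrow> bool" where
  "height_at_most G \<H> n \<longleftrightarrow>
     (\<forall>g K. distinct_cosets G \<H> (n + 1) g K \<longrightarrow> finite (\<Inter>i<n + 1. conjugate G (K i) (g i)))"

definition finite_height :: "('a, 'b) monoid_scheme \<Rightarrow> 'a set set \<Rightarrow> bool" where
  "finite_height G \<H> \<longleftrightarrow> (\<exists>n. height_at_most G \<H> n)"

text \<open>The condition includes \<open>i = j\<close>, so only infinite conjugates are counted; leaving it out would
  only admit additional collections of size one. An infinite collection contains finite ones of
  every size and so contributes \<open>\<infinity>\<close>.\<close>

definition width :: "('a, 'b) monoid_scheme \<Rightarrow> 'a set set \<Rightarrow> enat" where
  "width G \<H> = Sup {enat k | k. \<exists>g K. distinct_cosets G \<H> k g K \<and>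
     (\<forall>i<k. \<forall>j<k. infinite (conjugate G (K i) (g i) \<inter> conjugate G (K j) (g j)))}"

definition finite_width :: "('a, 'b) monoid_scheme \<Rightarrow> 'a set set \<Rightarrow> bool" where
  "finite_width G \<H> \<longleftrightarrow> width G \<H> < \<infinity>"

definition bounded_packing :: "('a, 'b) monoid_scheme \<Rightarrow> 'a set set \<Rightarrow> bool" where
  "bounded_packing G \<H> \<longleftrightarrow>
     (\<forall>S. finite_generating_set G S \<longrightarrow>
       (\<forall>D::real. 0 \<le> D \<longrightarrow> (\<exists>N. \<forall>\<C>.
          \<C> \<subseteq> {g <#\<^bsub>G\<^esub> H | g H. g \<in> carrier G \<and> H \<in> \<H>} \<and> card \<C> = N \<longrightarrow>
          (\<exists>A\<in>\<C>. \<exists>B\<in>\<C>. A \<noteq> B \<and> (\<forall>a\<in>A. \<forall>b\<in>B. D \<le> real (word_metric G S a b))))))"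

section \<open>Cayley graphs are geodesic metric spaces\<close>

locale connected_graph =
  fixes V :: "'a set" and E :: "('a \<times> 'a) set"
  assumes edges: "E \<subseteq> V \<times> V"
    and sym_edges: "sym E"
    and connected: "\<And>u v. u \<in> V \<Longrightarrow> v \<in> V \<Longrightarrow> \<exists>n. (u, v) \<in> E ^^ n"
begin

abbreviation "gd \<equiv> graph_dist E"
abbreviation "P \<equiv> graph_points V E"
abbreviation "D \<equiv> graph_points_dist V E"

lemma gd_path: "u \<in> V \<Longrightarrow> v \<in> V \<Longrightarrow> (u, v) \<in> E ^^ gd u v"
  unfolding graph_dist_def using connected by (rule LeastI_ex)

lemma gd_le: "(u, v) \<in> E ^^ n \<Longrightarrow> gd u v \<le> n"
  unfolding graph_dist_def by (rule Least_le)

lemma gd_self [simp]: "gd u u = 0"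
  using gd_le[of u u 0] by simp

lemma gd_eq_0: "u \<in> V \<Longrightarrow> v \<in> V \<Longrightarrow> gd u v = 0 \<longleftrightarrow> u = v"
  using gd_path[of u v] by auto

lemma gd_commute: "gd u v = gd v u"
proof -
  have "(v, u) \<in> E ^^ n" if "(u, v) \<in> E ^^ n" for u v n
    using that
  proof (induction n arbitrary: v)
    case (Suc n)
    then obtain w where "(u, w) \<in> E ^^ n" "(w, v) \<in> E" by auto
    then show ?case using Suc.IH sym_edges by (blast intro: relpow_Suc_I2 dest: symD)
  qed simp
  then have "(u, v) \<in> E ^^ n \<longleftrightarrow> (v, u) \<in> E ^^ n" for n by blast
  then show ?thesis by (simp add: graph_dist_def)
qed

lemma gd_triangle:
  assumes "u \<in> V" "v \<in> V" "w \<in> V"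
  shows "gd u w \<le> gd u v + gd v w"
  by (rule gd_le) (use assms gd_path in \<open>auto simp: relpow_add\<close>)

lemma gd_edge: "(u, v) \<in> E \<Longrightarrow> gd u v \<le> 1"
  by (rule gd_le) simp

lemma supp_iff: "x \<in> supp p \<longleftrightarrow> p x \<noteq> 0"
  by (simp add: supp_def)

lemma point_cases:
  assumes "p \<in> P"
  obtains (vertex) u where "u \<in> V" "supp p = {u}" "p u = 1"
  | (edge) u v where "u \<in> V" "v \<in> V" "u \<noteq> v" "(u, v) \<in> E" "supp p = {u, v}" "p u + p v = 1"
proof -
  obtain u v where uv: "u \<in> V" "v \<in> V" "u = v \<or> (u, v) \<in> E" "supp p \<subseteq> {u, v}" "sum p {u, v} = 1"
    using assms unfolding graph_points_def by blast
  have off: "p x = 0" if "x \<noteq> u" "x \<noteq> v" for x using uv(4) that supp_iff[of x p] by blast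
  consider "u = v" | "u \<noteq> v" "p u = 0" | "u \<noteq> v" "p v = 0" | "u \<noteq> v" "p u \<noteq> 0" "p v \<noteq> 0" by blast
  then show thesis
  proof cases
    case 1
    then have "p u = 1" using uv(5) by simp
    moreover have "supp p = {u}" using 1 off calculation supp_iff[of _ p] by force
    ultimately show thesis using that(1) uv(1) by blast
  next
    case 2
    then have "p v = 1" using uv(5) by simp
    moreover have "supp p = {v}" using 2 off calculation supp_iff[of _ p] by force
    ultimately show thesis using that(1) uv(2) by blast
  next
    case 3
    then have "p u = 1" using uv(5) by simp
    moreover have "supp p = {u}" using 3 off calculation supp_iff[of _ p] by force
    ultimately show thesis using that(1) uv(1) by blast
  next
    case 4
    then have "p u + p v = 1" using uv(5) by simp
    moreover have "supp p = {u, v}" using 4 uv(4) supp_iff[of _ p] by blast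
    ultimately show thesis using that(2) uv(1-3) 4 by blast
  qed
qed

lemma point_nonneg: "p \<in> P \<Longrightarrow> 0 \<le> p x"
  by (simp add: graph_points_def)

lemma point_le_1:
  assumes "p \<in> P" shows "p x \<le> 1"
proof (cases "x \<in> supp p")
  case True
  from assms show ?thesis
  proof (cases rule: point_cases)
    case (vertex u)
    then show ?thesis using True by simp
  next
    case (edge u v)
    then have "p x = p u \<or> p x = p v" using True by auto
    then show ?thesis using edge(6) point_nonneg[OF assms, of u] point_nonneg[OF assms, of v] by linarith
  qed
qed (simp add: supp_iff)

lemma supp_finite [simp]: "p \<in> P \<Longrightarrow> finite (supp p)"
  by (erule point_cases) auto

lemma supp_nonempty: "p \<in> P \<Longrightarrow> supp p \<noteq> {}"
  by (erule point_cases) auto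

lemma supp_V: "p \<in> P \<Longrightarrow> supp p \<subseteq> V"
  by (erule point_cases) auto

lemma supp_two: "p \<in> P \<Longrightarrow> x \<in> supp p \<Longrightarrow> y \<in> supp p \<Longrightarrow> x \<noteq> y \<Longrightarrow> p x + p y = 1"
  by (erule point_cases) auto

lemma point_eqI:
  assumes "\<And>x. x \<in> supp p \<union> supp q \<Longrightarrow> p x = q x" shows "p = q"
proof
  fix x show "p x = q x"
    using assms[of x] by (cases "x \<in> supp p \<union> supp q") (auto simp: supp_iff)
qed

lemma edge_coord:
  assumes "p \<in> P" "supp p \<subseteq> {u, v}" "u \<noteq> v" shows "p v = 1 - p u"
  using assms(1)
proof (cases rule: point_cases)
  case (vertex w)
  then have "w = u \<or> w = v" using assms by blast
  moreover have "p x = 0" if "x \<noteq> w" for x using vertex(2) that supp_iff[of x p] by blast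
  ultimately show ?thesis using vertex(3) assms(3) by auto
next
  case (edge a b)
  then have "{a, b} = {u, v}" using assms by auto
  then show ?thesis using edge by (auto simp: doubleton_eq_iff)
qed

lemma single_coord: "p \<in> P \<Longrightarrow> supp p \<subseteq> {u} \<Longrightarrow> p u = 1"
  by (erule point_cases) auto

lemma other_end:
  assumes "a = b \<or> (a, b) \<in> E" "A \<subseteq> {a, b}" "v \<in> A"
  obtains c where "v = c \<or> (v, c) \<in> E" "A \<subseteq> {v, c}"
proof (cases "v = a")
  case True
  then show thesis using that[of b] assms by blast
next
  case False
  then have "v = b" using assms by blast
  then show thesis using that[of a] assms sym_edges by (blast dest: symD)
qed

lemma same_edge_commute: "same_edge E p q \<longleftrightarrow> same_edge E q p"
  by (simp add: same_edge_def Un_commute)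

lemma D_edge:
  assumes "p \<in> P" "q \<in> P" "u = v \<or> (u, v) \<in> E" "supp p \<union> supp q \<subseteq> {u, v}"
  shows "D p q = \<bar>p u - q u\<bar>"
proof -
  have "same_edge E p q" using assms by (auto simp: same_edge_def)
  then have "D p q = (\<Sum>x\<in>supp p \<union> supp q. \<bar>p x - q x\<bar>) / 2"
    using assms by (simp add: graph_points_dist_def)
  also have "(\<Sum>x\<in>supp p \<union> supp q. \<bar>p x - q x\<bar>) = (\<Sum>x\<in>{u, v}. \<bar>p x - q x\<bar>)"
    by (rule sum.mono_neutral_left) (use assms in \<open>auto simp: supp_def\<close>)
  also have "\<dots> / 2 = \<bar>p u - q u\<bar>"
  proof (cases "u = v")
    case True
    then show ?thesis using single_coord[of p u] single_coord[of q u] assms by auto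
  next
    case False
    then have "p v = 1 - p u" "q v = 1 - q u" using edge_coord assms by auto
    then show ?thesis using False by simp
  qed
  finally show ?thesis .
qed

lemma D_commute: "D p q = D q p"
proof -
  have "(\<lambda>(u, v). (1 - p u) + real (gd u v) + (1 - q v)) ` (supp p \<times> supp q) =
        (\<lambda>(u, v). (1 - q u) + real (gd u v) + (1 - p v)) ` (supp q \<times> supp p)" for p q
    by (force simp: gd_commute algebra_simps image_iff)
  then show ?thesis
    by (simp add: graph_points_dist_def same_edge_commute Un_commute abs_minus_commute)
qed

lemma D_le:
  assumes "p \<in> P" "q \<in> P" "u \<in> supp p" "v \<in> supp q"
  shows "D p q \<le> (1 - p u) + real (gd u v) + (1 - q v)"
proof (cases "same_edge E p q")
  case True
  then obtain a b where ab: "a = b \<or> (a, b) \<in> E" "supp p \<union> supp q \<subseteq> {a, b}"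
    by (auto simp: same_edge_def)
  then have ba: "b = a \<or> (b, a) \<in> E" "supp p \<union> supp q \<subseteq> {b, a}"
    using sym_edges by (auto dest: symD)
  note bounds = point_le_1[OF assms(1)] point_le_1[OF assms(2)]
    point_nonneg[OF assms(1)] point_nonneg[OF assms(2)]
  show ?thesis
  proof (cases "u = v")
    case True
    then have "D p q = \<bar>p u - q u\<bar>"
      using D_edge[OF assms(1,2) ab] D_edge[OF assms(1,2) ba] ab assms by auto
    then show ?thesis using True bounds[of u] by auto
  next
    case False
    then have "1 \<le> gd u v" using gd_eq_0[of u v] supp_V assms by fastforce
    moreover have "D p q \<le> 1"
      using D_edge[OF assms(1,2) ab] bounds[of a] by (auto simp: abs_le_iff)
    ultimately show ?thesis using bounds(1)[of u] bounds(2)[of v] by linarith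
  qed
next
  case False
  then show ?thesis
    using assms by (auto simp: graph_points_dist_def intro!: Min_le)
qed

lemma D_attained:
  assumes "p \<in> P" "q \<in> P" "\<not> same_edge E p q"
  obtains u v where "u \<in> supp p" "v \<in> supp q" "D p q = (1 - p u) + real (gd u v) + (1 - q v)"
proof -
  let ?A = "(\<lambda>(u, v). (1 - p u) + real (gd u v) + (1 - q v)) ` (supp p \<times> supp q)"
  have "Min ?A \<in> ?A" using assms supp_nonempty by (intro Min_in) auto
  then show thesis using that assms by (auto simp: graph_points_dist_def)
qed

lemma D_nonneg: "0 \<le> D p q"
proof (cases "p \<in> P \<and> q \<in> P")
  case True
  show ?thesis
  proof (cases "same_edge E p q")
    case same: True
    then show ?thesis using True by (auto simp: graph_points_dist_def intro!: sum_nonneg)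
  next
    case False
    then obtain u v where "D p q = (1 - p u) + real (gd u v) + (1 - q v)"
      using D_attained True by blast
    then show ?thesis using point_le_1[of p u] point_le_1[of q v] True by simp
  qed
qed (auto simp: graph_points_dist_def)

lemma D_zero:
  assumes "p \<in> P" "q \<in> P" shows "D p q = 0 \<longleftrightarrow> p = q"
proof
  assume "p = q"
  obtain u v where "u = v \<or> (u, v) \<in> E" "supp p \<union> supp p \<subseteq> {u, v}"
    using assms by (auto simp: graph_points_def)
  then show "D p q = 0" using D_edge[OF assms(1) assms(1)] \<open>p = q\<close> by simp
next
  assume 0: "D p q = 0"
  show "p = q"
  proof (cases "same_edge E p q")
    case True
    then have "(\<Sum>x\<in>supp p \<union> supp q. \<bar>p x - q x\<bar>) = 0"
      using 0 assms by (simp add: graph_points_dist_def)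
    then show ?thesis using assms by (intro point_eqI) (auto simp: sum_nonneg_eq_0_iff)
  next
    case False
    then obtain u v where uv: "u \<in> supp p" "v \<in> supp q"
      "D p q = (1 - p u) + real (gd u v) + (1 - q v)"
      using D_attained assms by blast
    then have *: "p u = 1" "q v = 1" "gd u v = 0"
      using 0 point_le_1[OF assms(1), of u] point_le_1[OF assms(2), of v] by linarith+
    then have "u = v" using gd_eq_0 uv supp_V assms by blast
    have "supp p = {u}" using supp_two[OF assms(1) uv(1)] * uv(1) by (auto simp: supp_def)
    moreover have "supp q = {v}" using supp_two[OF assms(2) uv(2)] * uv(2) by (auto simp: supp_def)
    ultimately show ?thesis using * \<open>u = v\<close> by (intro point_eqI) auto
  qed
qed

lemma D_through:
  assumes "p \<in> P" "q \<in> P" "r \<in> P" "same_edge E p q" "v \<in> supp q" "w \<in> supp r"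
  shows "D p r \<le> D p q + ((1 - q v) + real (gd v w) + (1 - r w))"
proof -
  obtain a c where "a = c \<or> (a, c) \<in> E" "supp p \<union> supp q \<subseteq> {a, c}"
    using assms(4) unfolding same_edge_def by blast
  then obtain b where vb: "v = b \<or> (v, b) \<in> E" "supp p \<union> supp q \<subseteq> {v, b}"
    by (rule other_end) (use assms(5) in blast)
  have dir: "D p q = \<bar>p v - q v\<bar>" using D_edge[OF assms(1,2) vb] .
  show ?thesis
  proof (cases "v \<in> supp p")
    case True
    then show ?thesis using D_le[OF assms(1,3) True assms(6)] dir by linarith
  next
    case False
    then have pv: "p v = 0" by (simp add: supp_def)
    have b: "supp p = {b}" "v \<noteq> b" using False vb supp_nonempty[OF assms(1)] by auto
    then have pb: "p b = 1" using single_coord assms by blast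
    have "b \<in> V" "v \<in> V" "w \<in> V" using b supp_V assms by blast+
    then have "gd b w \<le> 1 + gd v w"
      using gd_triangle[of b v w] gd_edge[of v b] gd_commute[of b v] b vb by auto
    then have "real (gd b w) \<le> 1 + real (gd v w)" by linarith
    moreover have "D p r \<le> (1 - p b) + real (gd b w) + (1 - r w)"
      using D_le[OF assms(1,3) _ assms(6), of b] b by simp
    ultimately show ?thesis
      using dir pb pv point_nonneg[OF assms(2), of v] by linarith
  qed
qed

lemma D_triangle:
  assumes "p \<in> P" "q \<in> P" "r \<in> P" shows "D p r \<le> D p q + D q r"
proof -
  have part: "D p r \<le> D p q + D q r"
    if pqr: "p \<in> P" "q \<in> P" "r \<in> P" "same_edge E p q" "\<not> same_edge E q r" for p q r
  proof -
    obtain v w where "v \<in> supp q" "w \<in> supp r" "D q r = (1 - q v) + real (gd v w) + (1 - r w)"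
      by (rule D_attained[OF pqr(2,3,5)])
    then show ?thesis using D_through[OF pqr(1-4)] by metis
  qed
  consider "\<not> same_edge E p q" "\<not> same_edge E q r" | "same_edge E p q" "\<not> same_edge E q r"
    | "\<not> same_edge E p q" "same_edge E q r" | "same_edge E p q" "same_edge E q r" by blast
  then show ?thesis
  proof cases
    case 1
    obtain u v where uv: "u \<in> supp p" "v \<in> supp q" "D p q = (1 - p u) + real (gd u v) + (1 - q v)"
      using D_attained assms 1 by blast
    obtain x w where xw: "x \<in> supp q" "w \<in> supp r" "D q r = (1 - q x) + real (gd x w) + (1 - r w)"
      using D_attained assms 1 by blast
    have V: "u \<in> V" "v \<in> V" "x \<in> V" "w \<in> V" using uv xw supp_V assms by blast+
    have vx: "real (gd v x) \<le> (1 - q v) + (1 - q x)"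
    proof (cases "v = x")
      case True
      then show ?thesis using point_le_1[OF assms(2), of v] by simp
    next
      case False
      then have "(v, x) \<in> E" using uv(2) xw(1) sym_edges
        by (cases rule: point_cases[OF assms(2)]) (auto dest: symD)
      then show ?thesis using gd_edge[of v x] supp_two[OF assms(2) uv(2) xw(1) False] by simp
    qed
    have "gd u w \<le> gd u v + gd v x + gd x w"
      using gd_triangle[of u v w] gd_triangle[of v x w] V by linarith
    then have "real (gd u w) \<le> real (gd u v) + real (gd v x) + real (gd x w)" by linarith
    then show ?thesis using D_le[OF assms(1,3) uv(1) xw(2)] uv(3) xw(3) vx by linarith
  next
    case 2
    then show ?thesis using part assms by blast
  next
    case 3
    then show ?thesis using part[of r q p] assms same_edge_commute D_commute
      by (metis add.commute)
  next
    case 4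
    obtain c d where cd: "c = d \<or> (c, d) \<in> E" "supp q \<union> supp r \<subseteq> {c, d}"
      using 4 by (auto simp: same_edge_def)
    obtain a b where ab: "a = b \<or> (a, b) \<in> E" "supp p \<union> supp q \<subseteq> {a, b}"
      using 4 by (auto simp: same_edge_def)
    show ?thesis
      using assms(2)
    proof (cases rule: point_cases)
      case (edge x y)
      then have "{a, b} = {x, y}" "{c, d} = {x, y}" using ab cd by auto
      then have *: "supp p \<union> supp q \<subseteq> {x, y}" "supp q \<union> supp r \<subseteq> {x, y}"
        "supp p \<union> supp r \<subseteq> {x, y}" using ab cd by auto
      show ?thesis
        using D_edge[OF assms(1,2) _ *(1)] D_edge[OF assms(2,3) _ *(2)] D_edge[OF assms(1,3) _ *(3)]
          edge(4) by auto
    next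
      case (vertex x)
      obtain d where d: "x = d \<or> (x, d) \<in> E" "supp q \<union> supp r \<subseteq> {x, d}"
        by (rule other_end[OF cd]) (use vertex in blast)+
      have dir: "D q r = \<bar>q x - r x\<bar>" using D_edge[OF assms(2,3) d] .
      have "\<exists>w\<in>supp r. real (gd x w) + (1 - r w) \<le> D q r"
      proof (cases "x \<in> supp r")
        case True
        then show ?thesis using dir vertex by (intro bexI[of _ x]) auto
      next
        case False
        then have "supp r = {d}" "x \<noteq> d" using d supp_nonempty[OF assms(3)] by auto
        moreover from this have "r d = 1" using single_coord[OF assms(3)] by auto
        ultimately show ?thesis using dir vertex d False gd_edge[of x d] by (auto simp: supp_def)
      qed
      then show ?thesis using D_through[OF assms 4(1), of x] vertex by fastforce
    qed
  qed
qed

lemma Metric_space_realization: "Metric_space P D"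
  by unfold_locales (auto simp: D_nonneg D_commute[of _ _] D_zero D_triangle intro: D_commute)

lemma mspace_graph_space [simp]: "mspace (graph_space V E) = P"
  unfolding graph_space_def by (rule Metric_space.mspace_metric[OF Metric_space_realization])

lemma mdist_graph_space [simp]: "mdist (graph_space V E) = D"
  unfolding graph_space_def by (rule Metric_space.mdist_metric[OF Metric_space_realization])

lemma supp_vertex [simp]: "supp (vertex u) = {u}"
  by (auto simp: supp_def vertex_def indicator_def)

lemma vertex_same [simp]: "vertex u u = 1"
  by (simp add: vertex_def)

lemma vertex_point [simp]: "u \<in> V \<Longrightarrow> vertex u \<in> P"
  unfolding graph_points_def by (auto simp: vertex_def supp_def indicator_def intro!: bexI[of _ u])

lemma D_vertex:
  assumes "u \<in> V" "v \<in> V" shows "D (vertex u) (vertex v) = gd u v"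
proof (cases "same_edge E (vertex u) (vertex v)")
  case True
  then obtain a b where "a = b \<or> (a, b) \<in> E" "{u, v} \<subseteq> {a, b}"
    by (auto simp: same_edge_def)
  then have *: "u = v \<or> (u, v) \<in> E" using sym_edges by (auto dest: symD)
  then have "D (vertex u) (vertex v) = \<bar>vertex u u - vertex v u\<bar>"
    using assms by (intro D_edge) auto
  moreover have "gd u v = (if u = v then 0 else 1)"
    using gd_edge[of u v] gd_eq_0[OF assms] * by auto
  ultimately show ?thesis by (auto simp: vertex_def)
next
  case False
  obtain a b where "a \<in> supp (vertex u)" "b \<in> supp (vertex v)"
    "D (vertex u) (vertex v) = (1 - vertex u a) + real (gd a b) + (1 - vertex v b)"
    using D_attained[OF _ _ False] assms by auto
  then show ?thesis by auto
qed

definition joined :: "('a \<Rightarrow> real) \<Rightarrow> ('a \<Rightarrow> real) \<Rightarrow> bool" where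
  "joined p q \<longleftrightarrow> (\<exists>\<gamma>. geodesic (graph_space V E) 0 (D p q) \<gamma> \<and> \<gamma> 0 = p \<and> \<gamma> (D p q) = q)"

lemma joined_edge:
  assumes "p \<in> P" "q \<in> P" "same_edge E p q" shows "joined p q"
proof (cases "p = q")
  case True
  then have "D p q = 0" "D p p = 0" using D_zero assms by auto
  then show ?thesis
    using True assms by (auto simp: joined_def geodesic_def intro!: exI[of _ "\<lambda>_. p"])
next
  case False
  obtain u v where uv: "u = v \<or> (u, v) \<in> E" "supp p \<union> supp q \<subseteq> {u, v}"
    using assms by (auto simp: same_edge_def)
  define L where "L = D p q"
  have L: "L = \<bar>p u - q u\<bar>" unfolding L_def by (rule D_edge[OF assms(1,2) uv])
  have "L > 0" using False D_zero[OF assms(1,2)] D_nonneg[of p q] by (simp add: L_def)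
  then have "u \<noteq> v" using L single_coord[OF assms(1), of u] single_coord[OF assms(2), of u] uv by auto
  have V: "u \<in> V" "v \<in> V" using uv \<open>u \<noteq> v\<close> edges by auto
  have pq: "p v = 1 - p u" "q v = 1 - q u" using edge_coord uv \<open>u \<noteq> v\<close> assms by auto
  define \<gamma> where "\<gamma> t = (\<lambda>x. (1 - t / L) * p x + (t / L) * q x)" for t
  have supp: "supp (\<gamma> t) \<subseteq> {u, v}" for t
  proof
    fix x assume "x \<in> supp (\<gamma> t)"
    then have "p x \<noteq> 0 \<or> q x \<noteq> 0" by (auto simp: supp_iff \<gamma>_def)
    then show "x \<in> {u, v}" using uv(2) supp_iff[of x p] supp_iff[of x q] by blast
  qed
  have P: "\<gamma> t \<in> P" if "t \<in> {0..L}" for t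
  proof -
    have "0 \<le> \<gamma> t x" for x
      using that \<open>L > 0\<close> point_nonneg assms by (auto simp: \<gamma>_def intro!: add_nonneg_nonneg)
    moreover have "sum (\<gamma> t) {u, v} = (1 - t / L) * (p u + p v) + (t / L) * (q u + q v)"
      using \<open>u \<noteq> v\<close> by (simp add: \<gamma>_def distrib_left)
    then have "sum (\<gamma> t) {u, v} = 1" using pq by simp
    ultimately show ?thesis
      using V uv(1) supp[of t] unfolding graph_points_def mem_Collect_eq by blast
  qed
  have "D (\<gamma> s) (\<gamma> t) = \<bar>s - t\<bar>" if "s \<in> {0..L}" "t \<in> {0..L}" for s t
  proof -
    have "D (\<gamma> s) (\<gamma> t) = \<bar>\<gamma> s u - \<gamma> t u\<bar>"
      by (rule D_edge) (use that P uv(1) supp in \<open>blast+\<close>)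
    also have "\<gamma> s u - \<gamma> t u = (t - s) / L * (p u - q u)"
      using \<open>L > 0\<close> by (simp add: \<gamma>_def field_simps)
    also have "\<bar>\<dots>\<bar> = \<bar>s - t\<bar>"
      using \<open>L > 0\<close> L by (simp add: abs_mult abs_minus_commute)
    finally show ?thesis .
  qed
  moreover have "\<gamma> 0 = p" "\<gamma> L = q" using \<open>L > 0\<close> by (auto simp: \<gamma>_def)
  ultimately show ?thesis
    using P \<open>L > 0\<close> unfolding joined_def geodesic_def L_def[symmetric] by (intro exI[of _ \<gamma>]) auto
qed

lemma joined_trans:
  assumes "joined p q" "joined q r" "D p r = D p q + D q r" shows "joined p r"
proof -
  define L where "L = D p q"
  define M where "M = D q r"
  obtain \<alpha> where a: "geodesic (graph_space V E) 0 L \<alpha>" "\<alpha> 0 = p" "\<alpha> L = q"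
    using assms(1) by (auto simp: joined_def L_def)
  obtain \<beta> where b: "geodesic (graph_space V E) 0 M \<beta>" "\<beta> 0 = q" "\<beta> M = r"
    using assms(2) by (auto simp: joined_def M_def)
  have LM: "0 \<le> L" "0 \<le> M" "D p r = L + M" using a b assms(3) by (auto simp: geodesic_def L_def M_def)
  have aP: "\<alpha> t \<in> P" if "t \<in> {0..L}" for t using a that by (auto simp: geodesic_def)
  have bP: "\<beta> t \<in> P" if "t \<in> {0..M}" for t using b that by (auto simp: geodesic_def)
  have aD: "D (\<alpha> s) (\<alpha> t) = \<bar>s - t\<bar>" if "s \<in> {0..L}" "t \<in> {0..L}" for s t
    using a that by (auto simp: geodesic_def)
  have bD: "D (\<beta> s) (\<beta> t) = \<bar>s - t\<bar>" if "s \<in> {0..M}" "t \<in> {0..M}" for s t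
    using b that by (auto simp: geodesic_def)
  define \<gamma> where "\<gamma> t = (if t \<le> L then \<alpha> t else \<beta> (t - L))" for t
  have mixed: "D (\<alpha> s) (\<beta> t) = L - s + t" if s: "s \<in> {0..L}" and t: "t \<in> {0..M}" for s t
  proof -
    have ends: "p \<in> P" "q \<in> P" "r \<in> P" using aP[of 0] bP[of 0] bP[of M] LM a b by auto
    have "D (\<alpha> s) q = L - s" "D p (\<alpha> s) = s" using aD[of s L] aD[of 0 s] a s LM by auto
    moreover have "D q (\<beta> t) = t" "D (\<beta> t) r = M - t" using bD[of 0 t] bD[of t M] b t LM by auto
    ultimately show ?thesis
      using D_triangle[OF aP[OF s] ends(2) bP[OF t]] D_triangle[OF ends(1) aP[OF s] ends(3)]
        D_triangle[OF aP[OF s] bP[OF t] ends(3)] LM by linarith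
  qed
  have "D (\<gamma> s) (\<gamma> t) = \<bar>s - t\<bar>" if "s \<in> {0..L + M}" "t \<in> {0..L + M}" for s t
  proof -
    consider "s \<le> L" "t \<le> L" | "s \<le> L" "L < t" | "L < s" "t \<le> L" | "L < s" "L < t" by linarith
    then show ?thesis
    proof cases
      case 1
      then show ?thesis using that aD[of s t] by (simp add: \<gamma>_def)
    next
      case 2
      then show ?thesis using that mixed[of s "t - L"] by (simp add: \<gamma>_def)
    next
      case 3
      then show ?thesis
        using that mixed[of t "s - L"] D_commute[of "\<alpha> t" "\<beta> (s - L)"] by (simp add: \<gamma>_def)
    next
      case 4
      then show ?thesis using that bD[of "s - L" "t - L"] by (simp add: \<gamma>_def)
    qed
  qed
  moreover have "\<gamma> t \<in> P" if "t \<in> {0..L + M}" for t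
    using that aP[of t] bP[of "t - L"] by (auto simp: \<gamma>_def)
  moreover have "\<gamma> 0 = p" using a LM by (simp add: \<gamma>_def)
  moreover have "\<gamma> (L + M) = r" using a b LM by (cases "M = 0") (auto simp: \<gamma>_def)
  ultimately show ?thesis
    using LM unfolding joined_def geodesic_def by (intro exI[of _ \<gamma>]) auto
qed

lemma joined_vertices:
  assumes "u \<in> V" "v \<in> V" shows "joined (vertex u) (vertex v)"
  using assms
proof (induction "gd u v" arbitrary: v)
  case 0
  then have "u = v" using gd_eq_0[of u v] by simp
  then show ?case using 0 by (intro joined_edge) (auto simp: same_edge_def)
next
  case (Suc n)
  then have "(u, v) \<in> E ^^ Suc n" using gd_path[of u v] by simp
  then obtain w where w: "(u, w) \<in> E ^^ n" "(w, v) \<in> E" by auto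
  then have "w \<in> V" using edges by auto
  have gd: "gd u w = n" "gd w v = 1"
    using gd_le[OF w(1)] gd_edge[OF w(2)] gd_triangle[of u w v] Suc \<open>w \<in> V\<close> by auto
  have "joined (vertex u) (vertex w)" using Suc.hyps gd Suc.prems \<open>w \<in> V\<close> by auto
  moreover have "joined (vertex w) (vertex v)"
    using w \<open>w \<in> V\<close> Suc.prems by (intro joined_edge) (auto simp: same_edge_def)
  ultimately show ?case
    by (rule joined_trans) (use gd Suc \<open>w \<in> V\<close> in \<open>simp add: D_vertex flip: Suc.hyps(2)\<close>)
qed

lemma geodesic_space_realization: "geodesic_space (graph_space V E)"
proof -
  have end_edge: "same_edge E p (vertex u)" "D p (vertex u) = 1 - p u"
    if pu: "p \<in> P" "u \<in> supp p" for p u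
  proof -
    obtain c d where "c = d \<or> (c, d) \<in> E" "supp p \<subseteq> {c, d}"
      using pu(1) by (auto simp: graph_points_def)
    then obtain b where b: "u = b \<or> (u, b) \<in> E" "supp p \<union> supp (vertex u) \<subseteq> {u, b}"
      using other_end[of c d "supp p" u] pu(2) by auto
    then show "same_edge E p (vertex u)" by (auto simp: same_edge_def)
    have "u \<in> V" using pu supp_V by blast
    then have "D p (vertex u) = \<bar>p u - 1\<bar>" using D_edge[OF pu(1) _ b] by simp
    then show "D p (vertex u) = 1 - p u" using point_le_1[OF pu(1), of u] by simp
  qed
  have "joined p q" if pq: "p \<in> P" "q \<in> P" for p q
  proof (cases "same_edge E p q")
    case True
    then show ?thesis using joined_edge pq by blast
  next
    case False
    then obtain u v where uv: "u \<in> supp p" "v \<in> supp q"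
      "D p q = (1 - p u) + real (gd u v) + (1 - q v)" using D_attained pq by blast
    have V: "u \<in> V" "v \<in> V" using uv supp_V pq by blast+
    have Dp: "D p (vertex u) = 1 - p u" and Dq: "D (vertex v) q = 1 - q v"
      using end_edge(2)[OF pq(1) uv(1)] end_edge(2)[OF pq(2) uv(2)] D_commute by auto
    have jp: "joined p (vertex u)"
      using joined_edge[OF pq(1) _ end_edge(1)[OF pq(1) uv(1)]] V by simp
    have jq: "joined (vertex v) q"
      using joined_edge[OF _ pq(2)] end_edge(1)[OF pq(2) uv(2)] same_edge_commute V
        vertex_point by blast
    have Dpv: "D p (vertex v) = (1 - p u) + gd u v"
      using D_triangle[of p "vertex u" "vertex v"] D_triangle[of p "vertex v" q]
        D_vertex[OF V] Dp Dq uv pq V vertex_point by fastforce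
    have "joined p (vertex v)"
      using joined_trans[OF jp joined_vertices[OF V]] Dpv Dp D_vertex[OF V] by simp
    then show ?thesis using joined_trans[OF _ jq] Dpv Dq uv by simp
  qed
  then show ?thesis unfolding geodesic_space_def joined_def mspace_graph_space by blast
qed

end

lemma connected_graph_cayley:
  assumes "group G" "S \<subseteq> carrier G" "generate G S = carrier G"
  shows "connected_graph (carrier G) (cayley_edges G S)"
proof -
  interpret group G by fact
  let ?E = "cayley_edges G S"
  have gens: "s \<in> carrier G" if "s \<in> S \<union> m_inv G ` S" for s using that assms by auto
  have edge: "(g, g \<otimes>\<^bsub>G\<^esub> s) \<in> ?E" if "g \<in> carrier G" "s \<in> S \<union> m_inv G ` S" for g s
    using that unfolding cayley_edges_def by blast
  have path: "\<exists>n. (g, g \<otimes>\<^bsub>G\<^esub> x) \<in> ?E ^^ n" if "x \<in> generate G S" "g \<in> carrier G" for x g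
    using that
  proof (induction arbitrary: g)
    case one
    then show ?case by (intro exI[of _ 0]) simp
  next
    case (incl h)
    then show ?case using edge[of g h] by (intro exI[of _ 1]) simp
  next
    case (inv h)
    then show ?case using edge[of g "inv\<^bsub>G\<^esub> h"] by (intro exI[of _ 1]) simp
  next
    case (eng h1 h2)
    have h: "h1 \<in> carrier G" "h2 \<in> carrier G" using eng(1,2) assms by auto
    then obtain m n where "(g, g \<otimes>\<^bsub>G\<^esub> h1) \<in> ?E ^^ m"
      "(g \<otimes>\<^bsub>G\<^esub> h1, g \<otimes>\<^bsub>G\<^esub> h1 \<otimes>\<^bsub>G\<^esub> h2) \<in> ?E ^^ n"
      using eng.IH(1)[OF eng.prems] eng.IH(2)[of "g \<otimes>\<^bsub>G\<^esub> h1"] eng.prems by auto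
    then have "(g, g \<otimes>\<^bsub>G\<^esub> (h1 \<otimes>\<^bsub>G\<^esub> h2)) \<in> ?E ^^ (m + n)"
      using h eng.prems by (auto simp: relpow_add m_assoc)
    then show ?case by blast
  qed
  show ?thesis
  proof
    show "?E \<subseteq> carrier G \<times> carrier G" using gens by (auto simp: cayley_edges_def)
    show "sym ?E"
    proof (rule symI)
      fix a b assume "(a, b) \<in> ?E"
      then obtain s where s: "a \<in> carrier G" "b = a \<otimes>\<^bsub>G\<^esub> s" "s \<in> S \<union> m_inv G ` S"
        by (auto simp: cayley_edges_def)
      then have "inv\<^bsub>G\<^esub> s \<in> S \<union> m_inv G ` S" using assms by auto
      moreover have "b \<otimes>\<^bsub>G\<^esub> inv\<^bsub>G\<^esub> s = a" using s gens by (simp add: m_assoc)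
      ultimately show "(b, a) \<in> ?E" using edge[of b "inv\<^bsub>G\<^esub> s"] s gens by auto
    qed
    fix u v assume "u \<in> carrier G" "v \<in> carrier G"
    then show "\<exists>n. (u, v) \<in> ?E ^^ n"
      using path[of "inv\<^bsub>G\<^esub> u \<otimes>\<^bsub>G\<^esub> v" u] assms by (simp flip: m_assoc)
  qed
qed

lemma geodesic_space_cayley:
  assumes "group G" "finite_generating_set G S"
  shows "geodesic_space (cayley_space G S)"
  using connected_graph.geodesic_space_realization connected_graph_cayley assms
  unfolding cayley_space_def finite_generating_set_def by blast

end

theory Submission
  imports Defs
begin

text \<open>Stability enters through a single consequence, \<^emph>\<open>thin bigons\<close>: for all \<open>K\<close>, \<open>e\<close> there is a bound
\<open>B K e\<close> such that two \<open>(K, e)\<close>-quasigeodesics of the Cayley graph of \<open>G\<close> with the same endpoints in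
\<open>H\<close> stay within \<open>B K e\<close> of each other and of \<open>H\<close>. Indeed both stay close to the image of a geodesic of
\<open>H\<close> by stability, and a quasigeodesic that stays close to another one with the same endpoints leaves
no large gap along it (\<open>qpath_shadows\<close>, \<open>stable_embedding_thin_bigons\<close>). The property survives a
change of the generating set and left translation, so all cosets of \<open>H\<^sub>1, \<dots>, H\<^sub>l\<close> have thin bigons
with common bounds. The rest is geometry of a family of vertex sets with common bounds.

The basic tool is the elbow: if \<open>q\<close> is a point nearest to \<open>x\<close> on a geodesic, then a geodesic from
\<open>x\<close> to \<open>q\<close> followed by a piece of that geodesic is a \<open>(3, 0)\<close>-quasigeodesic (\<open>elbow_qpath\<close>). If its ends
are near a member \<open>Y\<close> of the family, then so is the whole elbow, and it fellow travels any geodesic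
between its ends. Hence triangles with corners near \<open>Y\<close> are slim, so that each member is hyperbolic,
although the ambient graph need not be. Moreover, if three members are pairwise close, then a point
of the first one is near the other two: project a point near both of them to a geodesic in the first.

For the packing, hyperbolicity gives a Helly property (\<open>coarse_helly\<close>): finitely many members that
are pairwise \<open>d\<close>-close have a common \<open>R\<close>-near point, where \<open>R\<close> does not depend on their number. In a
tree, the point closest to a root of the subtree farthest from the root lies in every subtree that
meets all others; the same choice works here coarsely, inside one member of the collection. All
cosets in a collection of pairwise close cosets therefore meet a ball of fixed radius, and this
bounds their number (\<open>close_cosets_bounded\<close>).

For height and width, let \<open>z\<close> lie in \<open>gHg\<inverse> \<inter> g'H'g'\<inverse>\<close>. Then \<open>g, zg \<in> gH\<close>, \<open>g', zg' \<in> g'H'\<close>, and \<open>zg\<close>, \<open>zg'\<close>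
are exactly as far apart as \<open>g\<close>, \<open>g'\<close>. If the intersection is infinite, then \<open>d(g, zg)\<close> is unbounded,
so the two cosets are parallel for an arbitrarily long time. This makes them close within a bound
that does not depend on \<open>d(g, g')\<close> (\<open>parallel_close\<close>): a shortest bridge between them, followed by a
long way along the second coset and a return to the first, is a \<open>(3, 0)\<close>-quasigeodesic with both ends
in the first coset, so the far end of the bridge is near the first coset. Conjugates with pairwise
infinite intersections thus belong to pairwise close cosets, and the packing bound limits their number.\<close>

section \<open>Quasigeodesic paths of vertices\<close>

context connected_graph
begin

text \<open>Paths only visit vertices and have natural constants; the lower bound on distances is solved for the
parameter. Consecutive vertices need not be adjacent, so a path can be extended by a jump to a
nearby vertex at the price of a larger \<open>e\<close>.\<close>

definition qpath :: "nat \<Rightarrow> nat \<Rightarrow> 'a \<Rightarrow> 'a \<Rightarrow> nat \<Rightarrow> (nat \<Rightarrow> 'a) \<Rightarrow> bool" where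
  "qpath K e x y n p \<longleftrightarrow> p 0 = x \<and> p n = y \<and> (\<forall>i\<le>n. p i \<in> V) \<and>
     (\<forall>i j. i \<le> j \<and> j \<le> n \<longrightarrow>
        j - i \<le> K * gd (p i) (p j) + e \<and> gd (p i) (p j) \<le> K * (j - i) + e)"

abbreviation "geodesic_path \<equiv> qpath 1 0"

definition near :: "'a set \<Rightarrow> nat \<Rightarrow> 'a \<Rightarrow> bool" where
  "near Y r x \<longleftrightarrow> (\<exists>y\<in>Y. gd x y \<le> r)"

lemma qpathD:
  assumes "qpath K e x y n p"
  shows "p 0 = x" "p n = y" "x \<in> V" "y \<in> V" "\<And>i. i \<le> n \<Longrightarrow> p i \<in> V"
    "\<And>i j. i \<le> j \<Longrightarrow> j \<le> n \<Longrightarrow> j - i \<le> K * gd (p i) (p j) + e"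
    "\<And>i j. i \<le> j \<Longrightarrow> j \<le> n \<Longrightarrow> gd (p i) (p j) \<le> K * (j - i) + e"
  using assms unfolding qpath_def by auto

lemma qpath_mono:
  assumes "qpath K e x y n p" "K \<le> K'" "e \<le> e'"
  shows "qpath K' e' x y n p"
proof -
  have mono: "K * a + e \<le> K' * a + e'" for a using assms(2,3) by (intro add_mono mult_right_mono) auto
  show ?thesis using assms(1) unfolding qpath_def by (meson mono order_trans)
qed

lemma qpath_reverse:
  assumes "qpath K e x y n p" shows "qpath K e y x n (\<lambda>k. p (n - k))"
  unfolding qpath_def
proof (intro conjI allI impI)
  fix i j assume "i \<le> j \<and> j \<le> n"
  then have "n - j \<le> n - i" "n - i \<le> n" and *: "(n - i) - (n - j) = j - i" by auto
  then show "j - i \<le> K * gd (p (n - i)) (p (n - j)) + e" "gd (p (n - i)) (p (n - j)) \<le> K * (j - i) + e"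
    using qpathD(6,7)[OF assms, of "n - j" "n - i"] * gd_commute[of "p (n - i)" "p (n - j)"] by auto
qed (use qpathD(1,2,5)[OF assms] in auto)

text \<open>The segment may be traversed in either direction, which spares case distinctions on the order of
two points of a path.\<close>

lemma qpath_segment:
  assumes "qpath K e x y n p" "i \<le> n" "j \<le> n"
  obtains m q where "qpath K e (p i) (p j) m q" "\<And>t. t \<le> m \<Longrightarrow> \<exists>k\<le>n. q t = p k"
    "\<And>k. (i \<le> k \<and> k \<le> j) \<or> (j \<le> k \<and> k \<le> i) \<Longrightarrow> \<exists>t\<le>m. q t = p k"
proof -
  have forward: "qpath K e (p i) (p j) (j - i) (\<lambda>k. p (i + k))" if ij: "i \<le> j" "j \<le> n" for i j
    unfolding qpath_def
  proof (intro conjI allI impI)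
    fix s t assume "s \<le> t \<and> t \<le> j - i"
    then show "t - s \<le> K * gd (p (i + s)) (p (i + t)) + e" "gd (p (i + s)) (p (i + t)) \<le> K * (t - s) + e"
      using qpathD(6,7)[OF assms(1), of "i + s" "i + t"] ij by auto
  qed (use qpathD(5)[OF assms(1)] ij in auto)
  show thesis
  proof (cases "i \<le> j")
    case True
    show thesis
    proof (rule that[OF forward[OF True assms(3)]])
      show "\<exists>k\<le>n. p (i + t) = p k" if "t \<le> j - i" for t using that assms(3) True
        by (intro exI[of _ "i + t"]) auto
      show "\<exists>t\<le>j - i. p (i + t) = p k" if "i \<le> k \<and> k \<le> j \<or> j \<le> k \<and> k \<le> i" for k
      proof -
        have "i \<le> k" "k \<le> j" using that True by auto
        then show ?thesis by (intro exI[of _ "k - i"]) auto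
      qed
    qed
  next
    case False
    then have ji: "j \<le> i" by simp
    show thesis
    proof (rule that[OF qpath_reverse[OF forward[OF ji assms(2)]]])
      show "\<exists>k\<le>n. p (j + (i - j - t)) = p k" if "t \<le> i - j" for t using that assms(2) ji
        by (intro exI[of _ "j + (i - j - t)"]) auto
      show "\<exists>t\<le>i - j. p (j + (i - j - t)) = p k" if "i \<le> k \<and> k \<le> j \<or> j \<le> k \<and> k \<le> i" for k
      proof -
        have "j \<le> k" "k \<le> i" using that ji by auto
        then show ?thesis by (intro exI[of _ "i - k"]) auto
      qed
    qed
  qed
qed

lemma geodesic_path_gd:
  assumes "geodesic_path x y n p" "i \<le> j" "j \<le> n"
  shows "gd (p i) (p j) = j - i"
  using qpathD(6,7)[OF assms] by simp

lemma geodesic_path_length: "geodesic_path x y n p \<Longrightarrow> n = gd x y"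
  using geodesic_path_gd[of x y n p 0 n] qpathD(1,2)[of 1 0 x y n p] by simp

lemma geodesic_path_exists:
  assumes "x \<in> V" "y \<in> V" obtains p n where "geodesic_path x y n p"
proof -
  define n where "n = gd x y"
  obtain p where p: "p 0 = x" "p n = y" "\<And>i. i < n \<Longrightarrow> (p i, p (Suc i)) \<in> E"
    using gd_path[OF assms] unfolding n_def[symmetric] relpow_fun_conv by blast
  have V: "p i \<in> V" if "i \<le> n" for i
    using p(3)[of "i - 1"] p(1) assms(1) that edges by (cases i) auto
  have le: "gd (p i) (p (i + k)) \<le> k" if "i + k \<le> n" for i k
    using that
  proof (induction k)
    case (Suc k)
    then show ?case
      using gd_triangle[of "p i" "p (i + k)" "p (Suc (i + k))"] gd_edge[OF p(3)[of "i + k"]]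
        V[of i] V[of "i + k"] V[of "Suc (i + k)"] by fastforce
  qed simp
  have "geodesic_path x y n p"
    unfolding qpath_def
  proof (intro conjI allI impI)
    fix i j assume "i \<le> j \<and> j \<le> n"
    then have ij: "i \<le> j" "j \<le> n" by auto
    then show "gd (p i) (p j) \<le> 1 * (j - i) + 0" using le[of i "j - i"] by simp
    have "n \<le> gd x (p i) + gd (p i) y" "gd (p i) y \<le> gd (p i) (p j) + gd (p j) y"
      unfolding n_def using gd_triangle assms V[of i] V[of j] ij by auto
    then show "j - i \<le> 1 * gd (p i) (p j) + 0"
      using le[of 0 i] le[of j "n - j"] ij p(1,2) by simp
  qed (use p V in auto)
  then show thesis by (rule that)
qed

lemma nearest_exists: "\<exists>m\<le>n. \<forall>i\<le>n. gd x (p m) \<le> gd x (p i)" for n :: nat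
  using ex_has_least_nat[of "\<lambda>m. m \<le> n" 0 "\<lambda>m. gd x (p m)"] by auto

lemma qpath_concat:
  assumes p: "qpath K 0 x y l p" and q: "qpath K 0 y z n q" and "1 \<le> K"
    and cross: "\<And>i j. i \<le> l \<Longrightarrow> j \<le> n \<Longrightarrow> (l - i) + j \<le> K * gd (p i) (q j)"
  shows "qpath K 0 x z (l + n) (\<lambda>k. if k \<le> l then p k else q (k - l))"
  unfolding qpath_def
proof (intro conjI allI impI)
  let ?r = "\<lambda>k. if k \<le> l then p k else q (k - l)"
  show "?r 0 = x" using qpathD(1)[OF p] by simp
  show "?r (l + n) = z" using qpathD(2)[OF p] qpathD(1,2)[OF q] by auto
  show "?r i \<in> V" if "i \<le> l + n" for i using that qpathD(5)[OF p] qpathD(5)[OF q] by auto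
  fix i j assume "i \<le> j \<and> j \<le> l + n"
  then have ij: "i \<le> j" "j \<le> l + n" by auto
  consider "j \<le> l" | "l < i" | "i \<le> l" "l < j" by linarith
  then show "j - i \<le> K * gd (?r i) (?r j) + 0" "gd (?r i) (?r j) \<le> K * (j - i) + 0"
  proof (atomize(full), cases)
    case 1
    then show "j - i \<le> K * gd (?r i) (?r j) + 0 \<and> gd (?r i) (?r j) \<le> K * (j - i) + 0"
      using qpathD(6,7)[OF p ij(1) 1] ij by simp
  next
    case 2
    then show "j - i \<le> K * gd (?r i) (?r j) + 0 \<and> gd (?r i) (?r j) \<le> K * (j - i) + 0"
      using qpathD(6,7)[OF q, of "i - l" "j - l"] ij by simp
  next
    case 3
    have V: "p i \<in> V" "p l \<in> V" "q (j - l) \<in> V" using qpathD(5)[OF p] qpathD(5)[OF q] 3 ij by auto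
    have "gd (p i) (q (j - l)) \<le> gd (p i) (p l) + gd (q 0) (q (j - l))"
      using gd_triangle[OF V] qpathD(2)[OF p] qpathD(1)[OF q] by simp
    also have "\<dots> \<le> K * (l - i) + K * (j - l)"
    proof (rule add_mono)
      show "gd (p i) (p l) \<le> K * (l - i)" using qpathD(7)[OF p, of i l] 3 by simp
      have "j - l \<le> n" using ij by simp
      then show "gd (q 0) (q (j - l)) \<le> K * (j - l)" using qpathD(7)[OF q, of 0 "j - l"] by simp
    qed
    also have "\<dots> = K * (j - i)" using 3 ij by (simp flip: distrib_left)
    finally show "j - i \<le> K * gd (?r i) (?r j) + 0 \<and> gd (?r i) (?r j) \<le> K * (j - i) + 0"
      using 3 ij cross[of i "j - l"] by simp
  qed
qed

text \<open>Since \<open>q\<close> is nearest to \<open>x\<close>, it is also nearest to each \<open>\<beta> i\<close>: a shortcut from \<open>\<beta> i\<close> would be one from \<open>x\<close>.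
Hence \<open>d (\<beta> i) q \<le> d (\<beta> i) (\<alpha> j)\<close>, and \<open>d q (\<alpha> j) \<le> 2 * d (\<beta> i) (\<alpha> j)\<close> by the triangle inequality. These
add up to the factor \<open>3\<close>.\<close>

lemma elbow_qpath:
  assumes b: "geodesic_path x q l \<beta>" and a: "geodesic_path q y n \<alpha>"
    and nearest: "\<And>j. j \<le> n \<Longrightarrow> gd x q \<le> gd x (\<alpha> j)"
  shows "qpath 3 0 x y (l + n) (\<lambda>k. if k \<le> l then \<beta> k else \<alpha> (k - l))"
proof (rule qpath_concat)
  show "qpath 3 0 x q l \<beta>" "qpath 3 0 q y n \<alpha>" using a b by (auto elim: qpath_mono)
  fix i j assume ij: "i \<le> l" "j \<le> n"
  have V: "\<beta> i \<in> V" "\<alpha> j \<in> V" "x \<in> V" "q \<in> V" using qpathD[OF a] qpathD[OF b] ij by auto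
  have "gd x (\<beta> i) = i" "gd (\<beta> i) q = l - i" "gd q (\<alpha> j) = j" "gd x q = l"
    using geodesic_path_gd[OF b, of 0 i] geodesic_path_gd[OF b, of i l] geodesic_path_gd[OF a, of 0 j]
      geodesic_path_length[OF b] qpathD(1,2)[OF b] qpathD(1,2)[OF a] ij by auto
  then show "l - i + j \<le> 3 * gd (\<beta> i) (\<alpha> j)"
    using nearest[OF ij(2)] gd_triangle[of x "\<beta> i" "\<alpha> j"] gd_triangle[of q "\<beta> i" "\<alpha> j"]
      gd_commute[of q "\<beta> i"] V ij by linarith
qed simp

text \<open>Used to replace endpoints near a set by endpoints in it. The new endpoints are added to the path
rather than substituted, so that the old vertices all remain on it; this shifts the
parameter by one.\<close>

lemma qpath_extend:
  assumes p: "qpath K e x y n p" and V: "x' \<in> V" "y' \<in> V" and r: "gd x x' \<le> r" "gd y y' \<le> r"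
  shows "qpath K (e + 2 * K * r + 2 * r + 2) x' y' (n + 2)
    (\<lambda>k. if k = 0 then x' else if k \<le> n + 1 then p (k - 1) else y')"
proof -
  define c where "c k = min (k - 1) n" for k
  define q where "q k = (if k = 0 then x' else if k \<le> n + 1 then p (k - 1) else y')" for k
  have qV: "q k \<in> V" for k using V qpathD(5)[OF p] by (auto simp: q_def)
  have cV: "p (c k) \<in> V" for k using qpathD(5)[OF p] by (auto simp: c_def)
  have close: "gd (q k) (p (c k)) \<le> r" "gd (p (c k)) (q k) \<le> r" if "k \<le> n + 2" for k
    using r qpathD(1,2)[OF p] gd_commute[of x'] gd_commute[of y'] that by (auto simp: q_def c_def)
  have "qpath K (e + 2 * K * r + 2 * r + 2) x' y' (n + 2) q"
    unfolding qpath_def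
  proof (intro conjI allI impI)
    show "q 0 = x'" "q (n + 2) = y'" by (auto simp: q_def)
    fix i j assume "i \<le> j \<and> j \<le> n + 2"
    then have ij: "i \<le> j" "j \<le> n + 2" "i \<le> n + 2" by auto
    then have c: "c i \<le> c j" "c j \<le> n" "j - i \<le> (c j - c i) + 2" "c j - c i \<le> j - i"
      unfolding c_def by auto
    have "gd (p (c i)) (p (c j)) \<le> gd (q i) (q j) + 2 * r"
      using gd_triangle[OF cV[of i] qV[of i] cV[of j]] gd_triangle[OF qV[of i] qV[of j] cV[of j]]
        close[OF ij(2)] close[OF ij(3)] by linarith
    then have "K * gd (p (c i)) (p (c j)) \<le> K * (gd (q i) (q j) + 2 * r)" by (rule mult_le_mono2)
    then show "j - i \<le> K * gd (q i) (q j) + (e + 2 * K * r + 2 * r + 2)"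
      using qpathD(6)[OF p c(1,2)] c(3) by (simp add: distrib_left)
    have "gd (q i) (q j) \<le> gd (p (c i)) (p (c j)) + 2 * r"
      using gd_triangle[OF qV[of i] cV[of i] qV[of j]] gd_triangle[OF cV[of i] cV[of j] qV[of j]]
        close[OF ij(2)] close[OF ij(3)] by linarith
    moreover have "K * (c j - c i) \<le> K * (j - i)" using c(4) by (rule mult_le_mono2)
    ultimately show "gd (q i) (q j) \<le> K * (j - i) + (e + 2 * K * r + 2 * r + 2)"
      using qpathD(7)[OF p c(1,2)] by linarith
  qed (use qV in auto)
  then show ?thesis unfolding q_def .
qed

lemma near_self: "z \<in> Z \<Longrightarrow> near Z r z"
  unfolding near_def by force

lemma near_mono: "near Y r x \<Longrightarrow> r \<le> s \<Longrightarrow> near Y s x"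
  unfolding near_def by (meson order_trans)

lemma near_trans:
  assumes "near Y r x" "gd z x \<le> s" "Y \<subseteq> V" "x \<in> V" "z \<in> V" shows "near Y (s + r) z"
proof -
  obtain y where y: "y \<in> Y" "gd x y \<le> r" using assms(1) by (auto simp: near_def)
  have "gd z y \<le> gd z x + gd x y" using gd_triangle assms y by blast
  then show ?thesis using y assms(2) by (force simp: near_def)
qed

end

section \<open>Families of vertex sets with thin bigons\<close>

context connected_graph
begin

text \<open>For a subgroup of a group and suitable \<open>B\<close> this says that it is a stable (in particular quasiconvex and hyperbolic)
subgroup, without reference to a metric on the subgroup itself.\<close>

definition thin_bigons :: "(nat \<Rightarrow> nat \<Rightarrow> nat) \<Rightarrow> 'a set \<Rightarrow> bool" where
  "thin_bigons B Y \<longleftrightarrow> (\<forall>K e x y n p m q. x \<in> Y \<and> y \<in> Y \<and> qpath K e x y n p \<and> qpath K e x y m q \<longrightarrow>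
     (\<forall>i\<le>n. near Y (B K e) (p i) \<and> near (q ` {..m}) (B K e) (p i)))"

end

locale thin_family = connected_graph V E for V :: "'a set" and E +
  fixes \<Y> :: "'a set set" and B :: "nat \<Rightarrow> nat \<Rightarrow> nat"
  assumes family_V: "Y \<in> \<Y> \<Longrightarrow> Y \<subseteq> V"
    and family_thin: "Y \<in> \<Y> \<Longrightarrow> thin_bigons B Y"
begin

text \<open>The bound for bigons whose corners are only \<open>r\<close>-near a member: \<open>qpath_extend\<close> enlarges \<open>e\<close>, and a vertex
close to an added endpoint is \<open>r\<close> further from the original path.\<close>

definition fellow :: "nat \<Rightarrow> nat \<Rightarrow> nat \<Rightarrow> nat" where
  "fellow K e r = B K (e + 2 * K * r + 2 * r + 2) + r"

lemma bigon:
  assumes Y: "Y \<in> \<Y>" and p: "qpath K e x y n p" and q: "qpath K e x y m q"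
    and x: "near Y r x" and y: "near Y r y" and i: "i \<le> n"
  shows "near Y (fellow K e r) (p i)" "near (q ` {..m}) (fellow K e r) (p i)"
proof -
  let ?e = "e + 2 * K * r + 2 * r + 2"
  obtain x' y' where xy: "x' \<in> Y" "y' \<in> Y" "gd x x' \<le> r" "gd y y' \<le> r"
    using x y unfolding near_def by blast
  then have V': "x' \<in> V" "y' \<in> V" using family_V[OF Y] by auto
  let ?ext = "\<lambda>p n k. if k = 0 then x' else if k \<le> n + 1 then p (k - 1) else y'"
  have p': "qpath K ?e x' y' (n + 2) (?ext p n)" and q': "qpath K ?e x' y' (m + 2) (?ext q m)"
    using qpath_extend[OF p V' xy(3,4)] qpath_extend[OF q V' xy(3,4)] .
  have "i + 1 \<le> n + 2" using i by simp
  then have thin: "near Y (B K ?e) (?ext p n (i + 1))"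
      "near (?ext q m ` {..m + 2}) (B K ?e) (?ext p n (i + 1))"
    using family_thin[OF Y] xy(1,2) p' q' unfolding thin_bigons_def by blast+
  have pi: "?ext p n (i + 1) = p i" using i by simp
  show "near Y (fellow K e r) (p i)"
    using thin(1) near_mono unfolding pi fellow_def by auto
  obtain j where j: "j \<le> m + 2" "gd (p i) (?ext q m j) \<le> B K ?e"
    using thin(2) unfolding pi near_def bex_simps(7) Bex_def atMost_iff by blast
  have V: "p i \<in> V" "q 0 \<in> V" "q m \<in> V" using qpathD(5)[OF p i] qpathD(5)[OF q] by auto
  have ends: "gd x' (q 0) \<le> r" "gd y' (q m) \<le> r"
    using xy gd_commute qpathD(1,2)[OF q] by auto
  consider "j = 0" | "0 < j" "j \<le> m + 1" | "j = m + 2" using j(1) by linarith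
  then have "\<exists>k\<le>m. gd (p i) (q k) \<le> B K ?e + r"
  proof cases
    case 1
    then show ?thesis
      using j(2) gd_triangle[OF V(1) V'(1) V(2)] ends by (intro exI[of _ 0]) simp
  next
    case 2
    then show ?thesis using j(2) by (intro exI[of _ "j - 1"]) auto
  next
    case 3
    then show ?thesis
      using j(2) gd_triangle[OF V(1) V'(2) V(3)] ends by (intro exI[of _ m]) simp
  qed
  then show "near (q ` {..m}) (fellow K e r) (p i)"
    unfolding near_def fellow_def by auto
qed

text \<open>The elbow from \<open>x\<close> over its nearest point \<open>\<alpha> m\<close> to \<open>\<alpha> i\<close> forms a bigon with \<open>\<beta>\<close>. Here \<open>\<alpha> i\<close> may be on
either side of \<open>\<alpha> m\<close>.\<close>

lemma nearest_point_thin: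
  assumes Y: "Y \<in> \<Y>" and a: "geodesic_path a b n \<alpha>" and m: "m \<le> n"
    and nearest: "\<And>i. i \<le> n \<Longrightarrow> gd x (\<alpha> m) \<le> gd x (\<alpha> i)"
    and i: "i \<le> n" and x: "near Y r x" and ai: "near Y r (\<alpha> i)"
    and b: "geodesic_path x (\<alpha> i) l \<beta>"
    and k: "m \<le> k \<and> k \<le> i \<or> i \<le> k \<and> k \<le> m"
  shows "near Y (fellow 3 0 r) (\<alpha> k)" "near (\<beta> ` {..l}) (fellow 3 0 r) (\<alpha> k)"
proof -
  have V: "x \<in> V" "\<alpha> m \<in> V" using qpathD(3)[OF b] qpathD(5)[OF a m] by auto
  obtain \<rho> l' where r: "geodesic_path x (\<alpha> m) l' \<rho>" using geodesic_path_exists[OF V] .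
  obtain m' q where q: "geodesic_path (\<alpha> m) (\<alpha> i) m' q" "\<And>t. t \<le> m' \<Longrightarrow> \<exists>k\<le>n. q t = \<alpha> k"
    "\<And>k. m \<le> k \<and> k \<le> i \<or> i \<le> k \<and> k \<le> m \<Longrightarrow> \<exists>t\<le>m'. q t = \<alpha> k"
    using qpath_segment[OF a m i] by metis
  let ?p = "\<lambda>k. if k \<le> l' then \<rho> k else q (k - l')"
  have "gd x (\<alpha> m) \<le> gd x (q j)" if "j \<le> m'" for j using q(2)[OF that] nearest by auto
  then have p: "qpath 3 0 x (\<alpha> i) (l' + m') ?p" by (rule elbow_qpath[OF r q(1)])
  obtain t where t: "t \<le> m'" "q t = \<alpha> k" using q(3)[OF k] by blast
  then have "?p (l' + t) = \<alpha> k" using qpathD(2)[OF r] qpathD(1)[OF q(1)] by auto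
  moreover have "qpath 3 0 x (\<alpha> i) l \<beta>" by (rule qpath_mono[OF b]) auto
  moreover have "l' + t \<le> l' + m'" using t by simp
  ultimately show "near Y (fellow 3 0 r) (\<alpha> k)" "near (\<beta> ` {..l}) (fellow 3 0 r) (\<alpha> k)"
    using bigon[OF Y p _ x ai, of l \<beta> "l' + t"] by auto
qed

text \<open>A vertex of the side \<open>\<alpha>\<close> lies on one of the two elbows through the point of \<open>\<alpha>\<close> nearest to the
opposite corner \<open>x\<close>, and each elbow is close to the other side that joins its ends.\<close>

lemma slim_triangle:
  assumes Y: "Y \<in> \<Y>" and a: "geodesic_path a b n \<alpha>"
    and xa: "geodesic_path x a l \<beta>" and xb: "geodesic_path x b l' \<gamma>"
    and near: "near Y r a" "near Y r b" "near Y r x" and k: "k \<le> n"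
  shows "near (\<beta> ` {..l}) (fellow 3 0 r) (\<alpha> k) \<or> near (\<gamma> ` {..l'}) (fellow 3 0 r) (\<alpha> k)"
proof -
  obtain m where m: "m \<le> n" "\<And>i. i \<le> n \<Longrightarrow> gd x (\<alpha> m) \<le> gd x (\<alpha> i)"
    using nearest_exists[of n x \<alpha>] by blast
  have ends: "\<alpha> 0 = a" "\<alpha> n = b" using qpathD[OF a] by auto
  show ?thesis
  proof (cases "k \<le> m")
    case True
    then show ?thesis
      using nearest_point_thin(2)[OF Y a m, of 0 r l \<beta> k] near xa ends by auto
  next
    case False
    then show ?thesis
      using nearest_point_thin(2)[OF Y a m, of n r l' \<gamma> k] near xb ends k by auto
  qed
qed

section \<open>The coarse Helly property\<close>

text \<open>The point is the one nearest to \<open>p\<close> on a geodesic from \<open>a1\<close> to \<open>a2\<close>. It lies on an elbow from \<open>p\<close> to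
\<open>a1\<close>, whose ends are near \<open>Y1\<close>, and on an elbow from \<open>p\<close> to \<open>a2\<close>, whose ends are near \<open>Y2\<close>.\<close>

lemma coarse_intersection:
  assumes fam: "Y \<in> \<Y>" "Y1 \<in> \<Y>" "Y2 \<in> \<Y>"
    and a1: "a1 \<in> Y" "near Y1 d a1" and a2: "a2 \<in> Y" "near Y2 d a2"
    and p: "p \<in> Y1" "near Y2 d p"
  shows "\<exists>q\<in>Y. near Y1 (fellow 1 0 0 + fellow 3 0 d) q \<and> near Y2 (fellow 1 0 0 + fellow 3 0 d) q"
proof -
  have V: "a1 \<in> V" "a2 \<in> V" "p \<in> V" using family_V fam a1 a2 p by blast+
  obtain \<alpha> n where a: "geodesic_path a1 a2 n \<alpha>" using geodesic_path_exists[OF V(1,2)] .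
  obtain m where m: "m \<le> n" "\<And>i. i \<le> n \<Longrightarrow> gd p (\<alpha> m) \<le> gd p (\<alpha> i)"
    using nearest_exists[of n p \<alpha>] by blast
  have ends: "\<alpha> 0 = a1" "\<alpha> n = a2" using qpathD[OF a] by auto
  have q: "\<alpha> m \<in> V" using qpathD(5)[OF a m(1)] .
  obtain \<beta> l where b: "geodesic_path p a1 l \<beta>" using geodesic_path_exists[OF V(3,1)] .
  obtain \<gamma> l' where c: "geodesic_path p a2 l' \<gamma>" using geodesic_path_exists[OF V(3,2)] .
  have q1: "near Y1 (fellow 3 0 d) (\<alpha> m)"
    using nearest_point_thin(1)[OF fam(2) a m, of 0 d l \<beta> m] ends a1 b near_self[OF p(1)] by simp
  have q2: "near Y2 (fellow 3 0 d) (\<alpha> m)"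
    using nearest_point_thin(1)[OF fam(3) a m, of n d l' \<gamma> m] ends a2 c p(2) m(1) by simp
  obtain q' where q': "q' \<in> Y" "gd (\<alpha> m) q' \<le> fellow 1 0 0"
    using bigon(1)[OF fam(1) a a near_self[OF a1(1)] near_self[OF a2(1)] m(1)] unfolding near_def by blast
  then have "gd q' (\<alpha> m) \<le> fellow 1 0 0" "q' \<in> V" using gd_commute family_V[OF fam(1)] by auto
  then show ?thesis using near_trans[OF q1] near_trans[OF q2] q q' family_V fam by blast
qed

text \<open>A connected and coarsely convex version of the part of \<open>Y\<close> that is \<open>r\<close>-near \<open>Z\<close>. Thin bigons keep it
close to both sets, and segments from it to points of \<open>Y\<close> that are \<open>r\<close>-near \<open>Z\<close> follow it.\<close>

definition coarse_hull :: "'a set \<Rightarrow> 'a set \<Rightarrow> nat \<Rightarrow> 'a set" where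
  "coarse_hull Y Z r = {\<alpha> i | \<alpha> i n b c. geodesic_path b c n \<alpha> \<and> i \<le> n \<and>
     b \<in> Y \<and> near Z r b \<and> c \<in> Y \<and> near Z r c}"

lemma hullI:
  "geodesic_path b c n \<alpha> \<Longrightarrow> i \<le> n \<Longrightarrow> b \<in> Y \<Longrightarrow> near Z r b \<Longrightarrow> c \<in> Y \<Longrightarrow> near Z r c \<Longrightarrow> \<alpha> i \<in> coarse_hull Y Z r"
  unfolding coarse_hull_def by blast

lemma hull_near:
  assumes "Y \<in> \<Y>" "Z \<in> \<Y>" "s \<in> coarse_hull Y Z r"
  shows "s \<in> V" "near Y (fellow 1 0 0) s" "near Z (fellow 1 0 r) s"
proof -
  obtain \<alpha> i n b c where h: "geodesic_path b c n \<alpha>" "i \<le> n" "b \<in> Y" "near Z r b" "c \<in> Y" "near Z r c"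
    "s = \<alpha> i" using assms(3) unfolding coarse_hull_def by blast
  show "s \<in> V" using qpathD(5)[OF h(1,2)] h(7) by simp
  show "near Y (fellow 1 0 0) s" using bigon(1)[OF assms(1) h(1,1) _ _ h(2)] near_self h by simp
  show "near Z (fellow 1 0 r) s" using bigon(1)[OF assms(2) h(1,1) _ _ h(2)] h by simp
qed

text \<open>In a tree the point of a subtree nearest to \<open>u\<close> lies on the path from \<open>u\<close> to any point \<open>p\<close> of the
subtree. In the coarse version, slim triangles move \<open>a\<close> to a point \<open>\<sigma> j\<close> on a geodesic from \<open>p\<close> to a
point of \<open>Y\<close> near \<open>Z\<close>. The point \<open>\<tau> q\<close> nearest to \<open>u\<close> on the segment from \<open>\<sigma> j\<close> to \<open>p\<close> is close to \<open>\<omega>\<close>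
and to a geodesic from \<open>u\<close> to \<open>\<sigma> j\<close>. As that segment lies in the hull, \<open>\<tau> q\<close> is hardly closer to \<open>u\<close> than
\<open>\<sigma> j\<close> is, and so \<open>\<tau> q\<close> and \<open>\<sigma> j\<close> are close.\<close>

lemma nearest_hull_point:
  assumes fam: "Y \<in> \<Y>" "Z \<in> \<Y>" and u: "u \<in> Y"
    and a: "a \<in> coarse_hull Y Z r" "\<And>s. s \<in> coarse_hull Y Z r \<Longrightarrow> gd u a \<le> gd u s"
    and p: "p \<in> Y" "near Z r p" and w: "geodesic_path u p n \<omega>"
  shows "near (\<omega> ` {..n}) (2 * fellow 3 0 0 + 3 * fellow 3 0 (fellow 1 0 0)) a"
proof -
  let ?d = "fellow 3 0 0" and ?D = "fellow 3 0 (fellow 1 0 0)"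
  obtain \<alpha> i m b c where h: "geodesic_path b c m \<alpha>" "i \<le> m" "b \<in> Y" "near Z r b" "c \<in> Y" "near Z r c"
    "a = \<alpha> i" using a(1) unfolding coarse_hull_def by blast
  have V: "u \<in> V" "p \<in> V" "b \<in> V" "c \<in> V" using family_V[OF fam(1)] u p h by auto
  obtain \<beta> l where b: "geodesic_path p b l \<beta>" using geodesic_path_exists[OF V(2,3)] .
  obtain \<gamma> l' where c: "geodesic_path p c l' \<gamma>" using geodesic_path_exists[OF V(2,4)] .
  have "near (\<beta> ` {..l}) ?d a \<or> near (\<gamma> ` {..l'}) ?d a"
    using slim_triangle[OF fam(1) h(1) b c _ _ _ h(2), of 0] near_self h p by simp
  then obtain \<sigma> k e j where s: "geodesic_path p e k \<sigma>" "e \<in> Y" "near Z r e" "j \<le> k"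
      "gd a (\<sigma> j) \<le> ?d"
    using b c h unfolding near_def by fastforce
  obtain k' \<tau> where t: "geodesic_path (\<sigma> j) (\<sigma> 0) k' \<tau>" "\<And>t. t \<le> k' \<Longrightarrow> \<exists>i\<le>k. \<tau> t = \<sigma> i"
    using qpath_segment[OF s(1) s(4), of 0] by (metis le0)
  have hull: "\<tau> t \<in> coarse_hull Y Z r" if "t \<le> k'" for t
    using t(2)[OF that] hullI[OF s(1) _ p s(2,3)] by auto
  have ends: "\<tau> 0 = \<sigma> j" "\<tau> k' = p" using qpathD(1,2)[OF t(1)] qpathD(1)[OF s(1)] by auto
  obtain q where q: "q \<le> k'" "\<And>i. i \<le> k' \<Longrightarrow> gd u (\<tau> q) \<le> gd u (\<tau> i)"
    using nearest_exists[of k' u \<tau>] by blast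
  have V': "\<tau> q \<in> V" "\<sigma> j \<in> V" "a \<in> V"
    using qpathD(5)[OF t(1) q(1)] qpathD(5)[OF s(1,4)] hull_near(1)[OF fam a(1)] by auto
  obtain \<zeta> z where z: "geodesic_path u (\<tau> 0) z \<zeta>" using geodesic_path_exists V V' ends by metis
  have "near Y (fellow 1 0 0) (\<tau> 0)" using hull_near(2)[OF fam hull] by simp
  then have "near (\<zeta> ` {..z}) ?D (\<tau> q)"
    using nearest_point_thin(2)[OF fam(1) t(1) q, of 0 _ z \<zeta> q] near_self[OF u] z by simp
  then obtain y where y: "y \<le> z" "gd (\<tau> q) (\<zeta> y) \<le> ?D" unfolding near_def by auto
  have "near (\<omega> ` {..n}) ?D (\<tau> q)"
    using nearest_point_thin(2)[OF fam(1) t(1) q, of k' _ n \<omega> q] near_self[OF u] near_self[OF p(1)]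
      w ends q(1) by simp
  then obtain x where x: "x \<le> n" "gd (\<tau> q) (\<omega> x) \<le> ?D" unfolding near_def by auto
  have W: "\<zeta> y \<in> V" "\<omega> x \<in> V" using qpathD(5)[OF z y(1)] qpathD(5)[OF w x(1)] by auto
  have "gd u (\<zeta> y) = y" "gd (\<zeta> y) (\<sigma> j) = z - y" "gd u (\<sigma> j) = z"
    using geodesic_path_gd[OF z, of 0 y] geodesic_path_gd[OF z, of y z] geodesic_path_length[OF z]
      qpathD(1,2)[OF z] y ends by auto
  moreover have "gd u a \<le> gd u (\<tau> q)" using a(2) hull q(1) by blast
  ultimately have "gd a (\<omega> x) \<le> 2 * ?d + 3 * ?D"
    using y x s(5) gd_commute[of "\<zeta> y" "\<tau> q"] gd_commute[of "\<sigma> j" a] gd_commute[of "\<zeta> y" "\<sigma> j"]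
      gd_commute[of "\<tau> q" "\<sigma> j"]
      gd_triangle[OF V(1) W(1) V'(1)] gd_triangle[OF V(1) V'(3) V'(2)]
      gd_triangle[OF V'(2) W(1) V'(1)] gd_triangle[OF V'(3) V'(2) W(2)]
      gd_triangle[OF V'(2) V'(1) W(2)]
    by linarith
  then show ?thesis using x(1) unfolding near_def by auto
qed

text \<open>Fix a member \<open>Y\<close> of the collection and a root \<open>u\<close> in it. For each member \<open>Z\<close> let \<open>a Z\<close> be a point
nearest to \<open>u\<close> of the hull of the part of \<open>Y\<close> near \<open>Z\<close>, and let \<open>X\<close> be a member for which \<open>a X\<close> is farthest
from \<open>u\<close>. For any \<open>Z\<close>, a point \<open>p\<close> of \<open>Y\<close> near \<open>X\<close> and \<open>Z\<close> gives a geodesic from \<open>u\<close> to \<open>p\<close> that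
passes coarsely through \<open>a Z\<close>, then through \<open>a X\<close>, and ends near \<open>Z\<close>. By thin bigons of \<open>Z\<close> the part from
\<open>a Z\<close> on stays near \<open>Z\<close>, and so \<open>a X\<close> is near \<open>Z\<close>.\<close>

lemma coarse_helly:
  "\<exists>R. \<forall>\<C>. finite \<C> \<and> \<C> \<subseteq> \<Y> \<and> \<C> \<noteq> {} \<and> (\<forall>Y\<in>\<C>. \<forall>Z\<in>\<C>. \<exists>y\<in>Y. near Z d y) \<longrightarrow>
     (\<exists>x\<in>V. \<forall>Z\<in>\<C>. near Z R x)"
proof -
  define r where "r = fellow 1 0 0 + fellow 3 0 d"
  define M where "M = 2 * fellow 3 0 0 + 3 * fellow 3 0 (fellow 1 0 0)"
  define s where "s = M + fellow 1 0 r"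
  define R where "R = 4 * M + fellow 1 0 r + M + fellow 1 0 (s + r)"
  have "\<exists>x\<in>V. \<forall>Z\<in>\<C>. near Z R x"
    if C: "finite \<C>" "\<C> \<subseteq> \<Y>" "\<C> \<noteq> {}" and close: "\<And>Y Z. Y \<in> \<C> \<Longrightarrow> Z \<in> \<C> \<Longrightarrow> \<exists>y\<in>Y. near Z d y" for \<C>
  proof -
    obtain Y where Y: "Y \<in> \<C>" "Y \<in> \<Y>" using C by blast
    obtain u where u: "u \<in> Y" using close[OF Y(1,1)] by blast
    have meet: "\<exists>p\<in>Y. near Z r p \<and> near Z' r p" if ZZ: "Z \<in> \<C>" "Z' \<in> \<C>" for Z Z'
    proof -
      obtain a1 a2 p where "a1 \<in> Y" "near Z d a1" "a2 \<in> Y" "near Z' d a2" "p \<in> Z" "near Z' d p"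
        using close Y(1) ZZ by meson
      then show ?thesis
        using coarse_intersection[of Y Z Z'] Y(2) ZZ C(2) unfolding r_def by blast
    qed
    have hull_nonempty: "\<exists>a. a \<in> coarse_hull Y Z r" if Z: "Z \<in> \<C>" for Z
    proof -
      obtain p where p: "p \<in> Y" "near Z r p" using meet[OF Z Z] by blast
      then have "p \<in> V" using family_V[OF Y(2)] by blast
      then obtain \<alpha> n where "geodesic_path p p n \<alpha>" using geodesic_path_exists by blast
      then show ?thesis using hullI[of p p n \<alpha> 0] p by blast
    qed
    define a where "a Z = (SOME a. a \<in> coarse_hull Y Z r \<and> (\<forall>s. s \<in> coarse_hull Y Z r \<longrightarrow> gd u a \<le> gd u s))" for Z
    have a: "a Z \<in> coarse_hull Y Z r" "\<And>s. s \<in> coarse_hull Y Z r \<Longrightarrow> gd u (a Z) \<le> gd u s" if Z: "Z \<in> \<C>" for Z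
    proof -
      obtain z where "z \<in> coarse_hull Y Z r" using hull_nonempty[OF Z] by blast
      then have "\<exists>a. a \<in> coarse_hull Y Z r \<and> (\<forall>s. s \<in> coarse_hull Y Z r \<longrightarrow> gd u a \<le> gd u s)"
        by (rule ex_has_least_nat)
      then have "a Z \<in> coarse_hull Y Z r \<and> (\<forall>s. s \<in> coarse_hull Y Z r \<longrightarrow> gd u (a Z) \<le> gd u s)"
        unfolding a_def by (rule someI_ex)
      then show "a Z \<in> coarse_hull Y Z r" "\<And>s. s \<in> coarse_hull Y Z r \<Longrightarrow> gd u (a Z) \<le> gd u s" by auto
    qed
    define h where "h = Max ((\<lambda>Z. gd u (a Z)) ` \<C>)"
    have "h \<in> (\<lambda>Z. gd u (a Z)) ` \<C>" unfolding h_def using C by (intro Max_in) auto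
    then obtain X where X: "X \<in> \<C>" "gd u (a X) = h" by auto
    have max: "gd u (a Z) \<le> gd u (a X)" if "Z \<in> \<C>" for Z
      unfolding X(2) h_def using C(1) that by (intro Max_ge) auto
    have fX: "X \<in> \<Y>" using X C by blast
    have aXV: "a X \<in> V" using hull_near(1)[OF Y(2) fX a(1)[OF X(1)]] .
    have "near Z R (a X)" if Z: "Z \<in> \<C>" for Z
    proof -
      have fZ: "Z \<in> \<Y>" using Z C by blast
      obtain p where p: "p \<in> Y" "near X r p" "near Z r p" using meet[OF X(1) Z] by blast
      have V: "u \<in> V" "p \<in> V" using family_V[OF Y(2)] u p by auto
      obtain \<omega> n where w: "geodesic_path u p n \<omega>" using geodesic_path_exists[OF V] .
      obtain i where i: "i \<le> n" "gd (a X) (\<omega> i) \<le> M"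
        using nearest_hull_point[OF Y(2) fX u a[OF X(1)] p(1,2) w] unfolding M_def near_def by auto
      obtain j where j: "j \<le> n" "gd (a Z) (\<omega> j) \<le> M"
        using nearest_hull_point[OF Y(2) fZ u a[OF Z] p(1,3) w] unfolding M_def near_def by auto
      have aZ: "a Z \<in> V" "near Z (fellow 1 0 r) (a Z)" using hull_near[OF Y(2) fZ a(1)[OF Z]] by auto
      have W: "\<omega> i \<in> V" "\<omega> j \<in> V" using qpathD(5)[OF w] i j by auto
      have pos: "gd u (\<omega> i) = i" "gd u (\<omega> j) = j"
        using geodesic_path_gd[OF w, of 0 i] geodesic_path_gd[OF w, of 0 j] qpathD(1)[OF w] i j by auto
      show ?thesis
      proof (cases "i \<le> j")
        case True
        then have "gd (\<omega> i) (\<omega> j) = j - i" using geodesic_path_gd[OF w] j by blast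
        \<comment> \<open>The choice of \<open>X\<close>: \<open>a Z\<close> is not farther from \<open>u\<close> than \<open>a X\<close>, so here the two points nearly coincide.\<close>
        moreover have "j \<le> i + 2 * M"
          using pos max[OF Z] i j gd_triangle[OF V(1) aZ(1) W(2)] gd_triangle[OF V(1) W(1) aXV]
            gd_commute[of "\<omega> i" "a X"] by linarith
        ultimately have "gd (a X) (a Z) \<le> 4 * M"
          using i j gd_triangle[OF aXV W(1) aZ(1)] gd_triangle[OF W(1,2) aZ(1)]
            gd_commute[of "\<omega> j" "a Z"] by linarith
        then have "near Z (4 * M + fellow 1 0 r) (a X)"
          using near_trans[OF aZ(2)] aZ aXV family_V[OF fZ] by blast
        then show ?thesis by (rule near_mono) (simp add: R_def)
      next
        case False
        then have ji: "j \<le> i" by simp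
        \<comment> \<open>Now \<open>\<omega> i\<close> lies between \<open>\<omega> j\<close> and \<open>\<omega> n = p\<close>, which are both near \<open>Z\<close>.\<close>
        obtain m q where q: "geodesic_path (\<omega> j) (\<omega> n) m q" "\<exists>t\<le>m. q t = \<omega> i"
          using qpath_segment[OF w j(1), of n] ji i(1) by (metis order_refl)
        then obtain t where t: "t \<le> m" "q t = \<omega> i" by blast
        have "gd (\<omega> j) (a Z) \<le> M" using j gd_commute by simp
        then have "near Z s (\<omega> j)"
          unfolding s_def using near_trans[OF aZ(2)] aZ W family_V[OF fZ] by blast
        then have "near Z (s + r) (\<omega> j)" "near Z (s + r) (\<omega> n)"
          using near_mono p(3) qpathD(2)[OF w] by auto
        then have "near Z (fellow 1 0 (s + r)) (\<omega> i)" using bigon(1)[OF fZ q(1) q(1) _ _ t(1)] t by simp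
        then have "near Z (M + fellow 1 0 (s + r)) (a X)"
          using near_trans i W aXV family_V[OF fZ] by blast
        then show ?thesis by (rule near_mono) (simp add: R_def)
      qed
    qed
    then show ?thesis using aXV by blast
  qed
  then show ?thesis by (intro exI[of _ R] allI impI) (elim conjE, simp)
qed

section \<open>Parallel members are uniformly close\<close>

text \<open>Let \<open>\<alpha> i\<close>, \<open>\<beta> j\<close> be the ends of a shortest bridge between a geodesic \<open>\<alpha>\<close> along \<open>Y\<close> and a geodesic \<open>\<beta>\<close>
along \<open>Z\<close>. From \<open>\<alpha> i\<close> cross this bridge, follow \<open>\<beta>\<close> to the point nearest to the end of \<open>\<alpha>\<close> that is
farther from \<open>\<alpha> i\<close>, and return to this end. Both turns are elbows, and the two crossings have length at
most \<open>d\<close>, which is short compared with the way along \<open>\<beta>\<close>; so the detour is a \<open>(3, 0)\<close>-quasigeodesic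
and passes within a bound independent of \<open>d\<close> of \<open>\<alpha>\<close>. Hence \<open>\<beta> j\<close> is within this bound of \<open>\<alpha>\<close>, and
as the bridge is shortest, its length obeys the same bound.\<close>

lemma parallel_close:
  assumes fam: "Y \<in> \<Y>" "Z \<in> \<Y>"
    and xy: "x \<in> Y" "x' \<in> Y" "y \<in> Z" "y' \<in> Z" "gd x y \<le> d" "gd x' y' \<le> d" "12 * d \<le> gd x x'"
  shows "\<exists>u\<in>Y. near Z (2 * fellow 1 0 0 + fellow 3 0 (fellow 1 0 0)) u"
proof -
  let ?d = "fellow 1 0 0"
  have V: "x \<in> V" "x' \<in> V" "y \<in> V" "y' \<in> V" using family_V fam xy by blast+
  obtain \<alpha> n where a: "geodesic_path x x' n \<alpha>" using geodesic_path_exists[OF V(1,2)] .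
  obtain \<beta> m where b: "geodesic_path y y' m \<beta>" using geodesic_path_exists[OF V(3,4)] .
  have aV: "\<alpha> i \<in> V" if "i \<le> n" for i using qpathD(5)[OF a that] .
  have bV: "\<beta> i \<in> V" if "i \<le> m" for i using qpathD(5)[OF b that] .
  have na: "near Y ?d (\<alpha> i)" if "i \<le> n" for i using bigon(1)[OF fam(1) a a _ _ that] near_self xy by simp
  have nb: "near Z ?d (\<beta> i)" if "i \<le> m" for i using bigon(1)[OF fam(2) b b _ _ that] near_self xy by simp
  have ends: "\<alpha> 0 = x" "\<alpha> n = x'" "\<beta> 0 = y" "\<beta> m = y'" using qpathD[OF a] qpathD[OF b] by auto
  have n: "n = gd x x'" using geodesic_path_length[OF a] .
  obtain i j where ij: "i \<le> n" "j \<le> m" and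
    min: "\<And>i' j'. i' \<le> n \<Longrightarrow> j' \<le> m \<Longrightarrow> gd (\<alpha> i) (\<beta> j) \<le> gd (\<alpha> i') (\<beta> j')"
  proof -
    have "\<exists>z. (fst z \<le> n \<and> snd z \<le> m) \<and>
      (\<forall>z'. fst z' \<le> n \<and> snd z' \<le> m \<longrightarrow> gd (\<alpha> (fst z)) (\<beta> (snd z)) \<le> gd (\<alpha> (fst z')) (\<beta> (snd z')))"
      by (rule ex_has_least_nat[of _ "(0, 0)"]) simp
    then obtain z where z: "fst z \<le> n" "snd z \<le> m"
      "\<And>z'. fst z' \<le> n \<Longrightarrow> snd z' \<le> m \<Longrightarrow> gd (\<alpha> (fst z)) (\<beta> (snd z)) \<le> gd (\<alpha> (fst z')) (\<beta> (snd z'))"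
      by blast
    show thesis by (rule that[OF z(1,2)]) (use z(3)[of "(_, _)"] in simp)
  qed
  \<comment> \<open>The end of \<open>\<alpha>\<close> farther from \<open>\<alpha> i\<close>, at distance at least \<open>n / 2\<close>.\<close>
  define e where "e = (if 2 * i \<le> n then n else 0)"
  have e: "e \<le> n" by (simp add: e_def)
  have far: "6 * d \<le> gd (\<alpha> i) (\<alpha> e)"
  proof (cases "2 * i \<le> n")
    case True
    then show ?thesis using geodesic_path_gd[OF a, of i n] ij xy n by (auto simp: e_def)
  next
    case False
    then show ?thesis
      using geodesic_path_gd[OF a, of 0 i] ij xy n gd_commute[of "\<alpha> i" "\<alpha> 0"] by (auto simp: e_def)
  qed
  obtain k where k: "k \<le> m" "\<And>i. i \<le> m \<Longrightarrow> gd (\<alpha> e) (\<beta> k) \<le> gd (\<alpha> e) (\<beta> i)"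
    using nearest_exists[of m "\<alpha> e" \<beta>] by blast
  have ek: "gd (\<alpha> e) (\<beta> k) \<le> d"
    using k(2)[of 0] k(2)[of m] ends xy by (auto simp: e_def split: if_splits)
  have ijd: "gd (\<alpha> i) (\<beta> j) \<le> d" using min[of 0 0] ends xy by auto
  obtain l \<rho> where r: "geodesic_path (\<alpha> i) (\<beta> j) l \<rho>" using geodesic_path_exists aV bV ij by metis
  obtain l' \<tau> where t: "geodesic_path (\<beta> k) (\<alpha> e) l' \<tau>" using geodesic_path_exists aV bV e k(1) by metis
  obtain L \<sigma> where s: "geodesic_path (\<beta> j) (\<beta> k) L \<sigma>" "\<And>t. t \<le> L \<Longrightarrow> \<exists>i\<le>m. \<sigma> t = \<beta> i"
    using qpath_segment[OF b ij(2) k(1)] by metis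
  have lens: "l \<le> d" "l' \<le> d" "L = gd (\<beta> j) (\<beta> k)"
    using geodesic_path_length[OF r] geodesic_path_length[OF t] geodesic_path_length[OF s(1)]
      ijd ek gd_commute[of "\<beta> k" "\<alpha> e"] by auto
  \<comment> \<open>At this length, \<open>l + L + l' \<le> 3 * (L - l - l')\<close>, which is the required bound between the two crossings.\<close>
  have L: "4 * d \<le> L"
    using far ijd ek lens(3) gd_triangle[OF aV[OF ij(1)] bV[OF ij(2)] aV[OF e]]
      gd_triangle[OF bV[OF ij(2)] bV[OF k(1)] aV[OF e]] gd_commute[of "\<beta> k" "\<alpha> e"] by linarith
  let ?rs = "\<lambda>t. if t \<le> l then \<rho> t else \<sigma> (t - l)"
  have rs: "qpath 3 0 (\<alpha> i) (\<beta> k) (l + L) ?rs"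
  proof (rule elbow_qpath[OF r s(1)])
    show "gd (\<alpha> i) (\<beta> j) \<le> gd (\<alpha> i) (\<sigma> t)" if "t \<le> L" for t using s(2)[OF that] min ij by auto
  qed
  \<comment> \<open>The turn at \<open>\<beta> k\<close> is an elbow seen from its other end \<open>\<alpha> e\<close>.\<close>
  have st: "(L - p) + q \<le> 3 * gd (\<sigma> p) (\<tau> q)" if pq: "p \<le> L" "q \<le> l'" for p q
  proof -
    have nearest: "gd (\<alpha> e) (\<beta> k) \<le> gd (\<alpha> e) (\<sigma> p)" using s(2)[OF pq(1)] k(2) by auto
    have W: "\<sigma> p \<in> V" "\<tau> q \<in> V" "\<alpha> e \<in> V" "\<beta> k \<in> V"
      using qpathD[OF s(1)] qpathD[OF t] pq by auto
    have "gd (\<sigma> p) (\<beta> k) = L - p" "gd (\<beta> k) (\<tau> q) = q" "gd (\<tau> q) (\<alpha> e) = l' - q" "gd (\<beta> k) (\<alpha> e) = l'"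
      using geodesic_path_gd[OF s(1), of p L] geodesic_path_gd[OF t, of 0 q]
        geodesic_path_gd[OF t, of q l'] geodesic_path_length[OF t]
        qpathD(1,2)[OF s(1)] qpathD(1,2)[OF t] pq by auto
    then show ?thesis
      using nearest pq gd_triangle[OF W(1,2,3)] gd_triangle[OF W(1,2,4)]
        gd_commute[of "\<alpha> e" "\<sigma> p"] gd_commute[of "\<tau> q" "\<beta> k"] gd_commute[of "\<alpha> e" "\<beta> k"] by linarith
  qed
  have path: "qpath 3 0 (\<alpha> i) (\<alpha> e) (l + L + l') (\<lambda>t. if t \<le> l + L then ?rs t else \<tau> (t - (l + L)))"
  proof (rule qpath_concat[OF rs])
    show "qpath 3 0 (\<beta> k) (\<alpha> e) l' \<tau>" by (rule qpath_mono[OF t]) auto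
    fix p q assume pq: "p \<le> l + L" "q \<le> l'"
    show "l + L - p + q \<le> 3 * gd (?rs p) (\<tau> q)"
    proof (cases "p \<le> l")
      case True
      have W: "\<rho> p \<in> V" "\<tau> q \<in> V" "\<beta> j \<in> V" "\<beta> k \<in> V"
        using qpathD[OF r] qpathD[OF s(1)] qpathD[OF t] pq True by auto
      have "gd (\<rho> p) (\<beta> j) = l - p" "gd (\<beta> k) (\<tau> q) = q"
        using geodesic_path_gd[OF r, of p l] geodesic_path_gd[OF t, of 0 q]
          qpathD(1,2)[OF r] qpathD(1,2)[OF t] pq True by auto
      then have "gd (\<beta> j) (\<beta> k) \<le> gd (\<rho> p) (\<tau> q) + d + d"
        using gd_triangle[OF W(3,1,4)] gd_triangle[OF W(1,2,4)] gd_commute[of "\<rho> p" "\<beta> j"]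
          gd_commute[of "\<beta> k" "\<tau> q"] lens pq by linarith
      then show ?thesis using True lens L pq by simp
    next
      case False
      then have "p - l \<le> L" "l + L - p + q = (L - (p - l)) + q" using pq by auto
      then show ?thesis using st[of "p - l" q] pq False by simp
    qed
  qed simp
  obtain N \<eta> where h: "geodesic_path (\<alpha> i) (\<alpha> e) N \<eta>" "\<And>t. t \<le> N \<Longrightarrow> \<exists>i\<le>n. \<eta> t = \<alpha> i"
    using qpath_segment[OF a ij(1) e] by metis
  have "qpath 3 0 (\<alpha> i) (\<alpha> e) N \<eta>" by (rule qpath_mono[OF h(1)]) auto
  then have "near (\<eta> ` {..N}) (fellow 3 0 ?d) (if l \<le> l + L then ?rs l else \<tau> (l - (l + L)))"
    using bigon(2)[OF fam(1) path _ na[OF ij(1)] na[OF e], of N \<eta> l] by simp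
  then obtain t where "t \<le> N" "gd (\<beta> j) (\<eta> t) \<le> fellow 3 0 ?d"
    using qpathD(2)[OF r] unfolding near_def by auto
  then obtain i' where "i' \<le> n" "gd (\<beta> j) (\<alpha> i') \<le> fellow 3 0 ?d" using h(2) by fastforce
  then have "gd (\<alpha> i) (\<beta> j) \<le> fellow 3 0 ?d" using min[of i' j] ij(2) gd_commute[of "\<alpha> i'"] by fastforce
  then have 1: "near Z (fellow 3 0 ?d + ?d) (\<alpha> i)"
    using near_trans[OF nb[OF ij(2)]] aV bV ij family_V[OF fam(2)] by blast
  obtain u where u: "u \<in> Y" "gd (\<alpha> i) u \<le> ?d" using na[OF ij(1)] unfolding near_def by blast
  have "near Z (?d + (fellow 3 0 ?d + ?d)) u"
    by (rule near_trans[OF 1]) (use u gd_commute family_V fam aV ij in auto)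
  then have "near Z (2 * ?d + fellow 3 0 ?d) u" by (rule near_mono) simp
  then show ?thesis using u(1) by blast
qed

end

section \<open>From stability to thin bigons\<close>

context connected_graph
begin

lemma D_vertex_of_supp:
  assumes "p \<in> P" "u \<in> supp p" shows "D p (vertex u) \<le> 1"
proof -
  have "u \<in> V" using assms supp_V by blast
  then have "D p (vertex u) \<le> (1 - p u) + real (gd u u) + (1 - vertex u u)"
    using assms by (intro D_le) auto
  then show ?thesis using point_nonneg[OF assms(1), of u] by simp
qed

text \<open>As quasigeodesics need not be continuous, the step function through the vertices of the path
suffices. Rounding the parameter costs an additive constant.\<close>

lemma quasigeodesic_of_qpath:
  assumes p: "qpath K e x y n p"
  shows "quasigeodesic (graph_space V E) (real (K + 1)) (real (K + e + 1)) 0 (real n)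
    (\<lambda>t. vertex (p (nat \<lfloor>t\<rfloor>)))"
  unfolding quasigeodesic_def qi_embedding_def
proof (intro conjI ballI)
  show "(\<lambda>t. vertex (p (nat \<lfloor>t\<rfloor>))) \<in> mspace (submetric euclidean_metric {0..real n}) \<rightarrow> mspace (graph_space V E)"
    using qpathD(5)[OF p] by (auto simp: nat_le_iff floor_le_iff)
  fix s t :: real
  have main: "\<bar>s - t\<bar> / real (K + 1) - real (K + e + 1) \<le> real (gd (p (nat \<lfloor>s\<rfloor>)) (p (nat \<lfloor>t\<rfloor>))) \<and>
      real (gd (p (nat \<lfloor>s\<rfloor>)) (p (nat \<lfloor>t\<rfloor>))) \<le> real (K + 1) * \<bar>s - t\<bar> + real (K + e + 1)"
    if st: "0 \<le> s" "s \<le> t" "t \<le> real n" for s t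
  proof -
    define i j where "i = nat \<lfloor>s\<rfloor>" and "j = nat \<lfloor>t\<rfloor>"
    have ij: "i \<le> j" "j \<le> n"
      unfolding i_def j_def using st by linarith+
    have r: "real i \<le> s" "s < real i + 1" "real j \<le> t" "t < real j + 1"
      unfolding i_def j_def using st by linarith+
    let ?g = "real (gd (p i) (p j))"
    have "real (j - i) \<le> real (K * gd (p i) (p j) + e)" "?g \<le> real (K * (j - i) + e)"
      using qpathD(6,7)[OF p ij] unfolding of_nat_le_iff by auto
    then have *: "real j - real i \<le> real K * ?g + real e" "?g \<le> real K * (real j - real i) + real e"
      using ij(1) by (auto simp: of_nat_diff)
    have "t - s \<le> real K * ?g + real e + 1" using * r by linarith
    also have "\<dots> \<le> real (K + 1) * (?g + real (K + e + 1))"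
      by (simp add: algebra_simps)
    finally have "(t - s) / real (K + 1) \<le> ?g + real (K + e + 1)"
      by (simp add: pos_divide_le_eq mult.commute)
    moreover have "real K * (real j - real i) \<le> real K * (t - s + 1)"
      using r by (intro mult_left_mono) auto
    then have "?g \<le> real K * (t - s + 1) + real e" using * by linarith
    then have "?g \<le> real (K + 1) * (t - s) + real (K + e + 1)" using st by (simp add: algebra_simps)
    ultimately show ?thesis using st(2) unfolding i_def j_def by simp
  qed
  assume "s \<in> mspace (submetric euclidean_metric {0..real n})" "t \<in> mspace (submetric euclidean_metric {0..real n})"
  then have st: "0 \<le> s" "s \<le> real n" "0 \<le> t" "t \<le> real n" by auto
  have V: "p (nat \<lfloor>s\<rfloor>) \<in> V" "p (nat \<lfloor>t\<rfloor>) \<in> V"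
    using qpathD(5)[OF p] st by (auto simp: nat_le_iff floor_le_iff)
  show "mdist (submetric euclidean_metric {0..real n}) s t / real (K + 1) - real (K + e + 1)
      \<le> mdist (graph_space V E) (vertex (p (nat \<lfloor>s\<rfloor>))) (vertex (p (nat \<lfloor>t\<rfloor>)))"
    "mdist (graph_space V E) (vertex (p (nat \<lfloor>s\<rfloor>))) (vertex (p (nat \<lfloor>t\<rfloor>)))
      \<le> real (K + 1) * mdist (submetric euclidean_metric {0..real n}) s t + real (K + e + 1)"
    using main[of s t] main[of t s] st gd_commute[of "p (nat \<lfloor>s\<rfloor>)" "p (nat \<lfloor>t\<rfloor>)"]
    by (cases "s \<le> t"; simp add: D_vertex V dist_real_def abs_minus_commute)+
qed auto

text \<open>The converse closeness for two paths with common endpoints: assign to each \<open>i\<close> a parameter \<open>k i\<close> on \<open>c\<close>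
with \<open>c (k i)\<close> near \<open>p i\<close>. The values \<open>k i\<close> start near \<open>0\<close>, end near \<open>N\<close> and have bounded jumps, so some
\<open>k i\<close> comes close to the given \<open>m\<close>.\<close>

lemma qpath_shadows:
  assumes c: "qpath K1 e1 x y N c" and p: "qpath K e x y n p"
    and close: "\<And>i. i \<le> n \<Longrightarrow> near (c ` {..N}) A (p i)" and m: "m \<le> N"
  shows "near (p ` {..n}) (A + K1 * (K1 * (2 * A + K + e) + e1) + e1) (c m)"
proof -
  let ?J = "K1 * (2 * A + K + e) + e1"
  have "\<forall>i\<in>{..n}. \<exists>k. k \<le> N \<and> gd (p i) (c k) \<le> A" using close unfolding near_def by auto
  then obtain k where k: "\<And>i. i \<le> n \<Longrightarrow> k i \<le> N" "\<And>i. i \<le> n \<Longrightarrow> gd (p i) (c (k i)) \<le> A"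
    unfolding bchoice_iff by auto
  have V: "p i \<in> V" "c (k i) \<in> V" if "i \<le> n" for i using qpathD(5)[OF p] qpathD(5)[OF c] k that by auto
  have jump: "b - a \<le> ?J" if "a \<le> b" "b \<le> N" "gd (c a) (c b) \<le> 2 * A + K + e" for a b
    using qpathD(6)[OF c that(1,2)] mult_le_mono2[OF that(3), of K1] by linarith
  have "\<exists>i\<le>n. m - k i \<le> ?J \<and> k i - m \<le> ?J"
  proof (cases "\<exists>i. i \<le> n \<and> m \<le> k i")
    case True
    \<comment> \<open>The first time that \<open>k\<close> reaches \<open>m\<close>; the preceding value is below \<open>m\<close>.\<close>
    define i where "i = (LEAST i. i \<le> n \<and> m \<le> k i)"
    have i: "i \<le> n" "m \<le> k i" using LeastI_ex[OF True] unfolding i_def by auto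
    have least: "k j < m" if "j < i" for j
      using not_less_Least[of j "\<lambda>i. i \<le> n \<and> m \<le> k i"] that i(1) unfolding i_def by auto
    have "k i - m \<le> ?J"
    proof (cases i)
      case 0
      have "gd (c 0) (c (k 0)) \<le> A" using k(2)[of 0] qpathD(1)[OF c] qpathD(1)[OF p] by simp
      then show ?thesis using jump[of 0 "k 0"] k(1)[OF i(1)] 0 by simp
    next
      case (Suc j)
      then have j: "j \<le> n" "k j \<le> k i" using i least[of j] by auto
      have "gd (p j) (p i) \<le> K + e" using qpathD(7)[OF p, of j i] i Suc by simp
      then have "gd (c (k j)) (c (k i)) \<le> 2 * A + K + e"
        using k(2)[OF j(1)] k(2)[OF i(1)] gd_commute[of "p j" "c (k j)"]
          gd_triangle[OF V(2)[OF j(1)] V(1)[OF j(1)] V(2)[OF i(1)]]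
          gd_triangle[OF V(1)[OF j(1)] V(1)[OF i(1)] V(2)[OF i(1)]] by linarith
      then have "k i - k j \<le> ?J" using jump[OF j(2) k(1)[OF i(1)]] by blast
      moreover have "k j < m" using least[of j] Suc by simp
      ultimately show ?thesis by linarith
    qed
    then show ?thesis using i by (intro exI[of _ i]) simp
  next
    case False
    then have "k n < m" by auto
    have "gd (c (k n)) (c N) \<le> A"
      using k(2)[of n] qpathD(2)[OF c] qpathD(2)[OF p] gd_commute by simp
    then have "N - k n \<le> ?J" using jump[of "k n" N] k(1)[of n] by simp
    then have "m - k n \<le> ?J" "k n - m \<le> ?J" using m \<open>k n < m\<close> by auto
    then show ?thesis by blast
  qed
  then obtain i where i: "i \<le> n" "m - k i \<le> ?J" "k i - m \<le> ?J" by blast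
  have "gd (c m) (c (k i)) \<le> K1 * ?J + e1"
  proof (cases "m \<le> k i")
    case True
    then show ?thesis
      using qpathD(7)[OF c True k(1)[OF i(1)]] mult_le_mono2[OF i(3), of K1] by linarith
  next
    case False
    then have "k i \<le> m" by simp
    then show ?thesis
      using qpathD(7)[OF c _ m, of "k i"] mult_le_mono2[OF i(2), of K1] gd_commute[of "c m" "c (k i)"]
      by linarith
  qed
  moreover have "gd (c m) (p i) \<le> gd (c m) (c (k i)) + gd (c (k i)) (p i)"
    using gd_triangle qpathD(5)[OF c m] V[OF i(1)] by blast
  ultimately have "gd (c m) (p i) \<le> A + K1 * ?J + e1"
    using k(2)[OF i(1)] gd_commute[of "p i" "c (k i)"] by linarith
  then show ?thesis using i(1) unfolding near_def by auto
qed

text \<open>It suffices to compare all paths between \<open>x\<close> and \<open>y\<close> with one reference path \<open>c\<close> in \<open>Y\<close> whose constants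
do not depend on \<open>x\<close> and \<open>y\<close>.\<close>

lemma thin_bigonsI:
  assumes "Y \<subseteq> V"
    and spine: "\<And>x y. x \<in> Y \<Longrightarrow> y \<in> Y \<Longrightarrow> \<exists>N c. qpath K1 e1 x y N c \<and> c ` {..N} \<subseteq> Y \<and>
      (\<forall>K e n p. qpath K e x y n p \<longrightarrow> (\<forall>i\<le>n. near (c ` {..N}) (A K e) (p i)))"
  shows "\<exists>B. thin_bigons B Y"
proof -
  let ?B = "\<lambda>K e. A K e + (A K e + K1 * (K1 * (2 * A K e + K + e) + e1) + e1)"
  have "thin_bigons ?B Y"
    unfolding thin_bigons_def
  proof (intro allI impI)
    fix K e x y n p m q i
    assume h: "x \<in> Y \<and> y \<in> Y \<and> qpath K e x y n p \<and> qpath K e x y m q" and i: "i \<le> n"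
    then have "x \<in> Y" "y \<in> Y" by auto
    from spine[OF this] obtain N c where c: "qpath K1 e1 x y N c" "c ` {..N} \<subseteq> Y"
      and "\<forall>K e n p. qpath K e x y n p \<longrightarrow> (\<forall>i\<le>n. near (c ` {..N}) (A K e) (p i))"
      by (elim exE conjE)
    then have c3: "near (c ` {..N}) (A K e) (p i)" if "qpath K e x y n p" "i \<le> n" for K e n p i
      using that by simp
    have p: "qpath K e x y n p" and q: "qpath K e x y m q" using h by auto
    obtain k where k: "k \<le> N" "gd (p i) (c k) \<le> A K e" using c3[OF p i] unfolding near_def by auto
    have V: "c k \<in> V" "p i \<in> V" using qpathD(5)[OF c(1) k(1)] qpathD(5)[OF p i] by auto
    have "q ` {..m} \<subseteq> V" using qpathD(5)[OF q] by auto
    then have "near (q ` {..m}) (?B K e) (p i)"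
      using near_trans[OF qpath_shadows[OF c(1) q c3[OF q] k(1)] k(2)] V by blast
    moreover have "near Y (A K e) (p i)" using k c(2) unfolding near_def by blast
    then have "near Y (?B K e) (p i)" by (rule near_mono) simp
    ultimately show "near Y (?B K e) (p i) \<and> near (q ` {..m}) (?B K e) (p i)" by blast
  qed
  then show ?thesis by blast
qed

text \<open>The reference path between \<open>x\<close> and \<open>y\<close> is a geodesic of the realization of the subgraph, read off at
parameters \<open>0, 1, 2, \<dots>\<close> and rounded to vertices. Rounding moves a point by at most \<open>1\<close>, so the rounded
path is a quasigeodesic in \<open>V\<close> with constants depending on those of \<open>\<Phi>\<close> only, and stability of the
image of the geodesic keeps every quasigeodesic from \<open>x\<close> to \<open>y\<close> near the rounded path.\<close>

lemma stable_embedding_thin_bigons: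
  assumes F: "connected_graph U F" and UV: "U \<subseteq> V"
    and vertex: "\<And>u. u \<in> U \<Longrightarrow> \<Phi> (vertex u) = vertex u"
    and stable: "stable_embedding (graph_space U F) (graph_space V E) \<Phi>"
  shows "\<exists>B. thin_bigons B U"
proof -
  interpret U: connected_graph U F by fact
  obtain K0 \<epsilon> where qi: "qi_embedding K0 \<epsilon> (graph_space U F) (graph_space V E) \<Phi>"
    using stable unfolding stable_embedding_def by blast
  obtain f where f: "\<And>a b \<gamma>. geodesic (graph_space U F) a b \<gamma> \<Longrightarrow>
      stable_quasigeodesic f (graph_space V E) a b (\<Phi> \<circ> \<gamma>)"
    using stable unfolding stable_embedding_def by blast
  have K0: "1 \<le> K0" "0 \<le> \<epsilon>" using qi by (auto simp: qi_embedding_def)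
  have \<Phi>P: "\<Phi> z \<in> P" if "z \<in> U.P" for z using qi that by (auto simp: qi_embedding_def)
  have upper: "D (\<Phi> z) (\<Phi> w) \<le> K0 * U.D z w + \<epsilon>" if "z \<in> U.P" "w \<in> U.P" for z w
    using qi that by (auto simp: qi_embedding_def)
  have lower: "U.D z w / K0 - \<epsilon> \<le> D (\<Phi> z) (\<Phi> w)" if "z \<in> U.P" "w \<in> U.P" for z w
    using qi that by (auto simp: qi_embedding_def)
  define K1 e1 where "K1 = nat \<lceil>K0\<rceil>" and "e1 = nat \<lceil>2 * K0 + K0 * \<epsilon> + \<epsilon> + 2\<rceil>"
  have K1: "K0 \<le> real K1" "2 * K0 + K0 * \<epsilon> + \<epsilon> + 2 \<le> real e1"
    unfolding K1_def e1_def by linarith+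
  define A where "A K e = nat \<lceil>f (real (K + 1)) (real (K + e + 1)) + 2 * K0 + \<epsilon>\<rceil>" for K e
  have A: "f (real (K + 1)) (real (K + e + 1)) + 2 * K0 + \<epsilon> \<le> real (A K e)" for K e
    unfolding A_def by linarith
  show ?thesis
  proof (rule thin_bigonsI[OF UV])
    fix x y assume x: "x \<in> U" and y: "y \<in> U"
    then have "vertex x \<in> mspace (graph_space U F)" "vertex y \<in> mspace (graph_space U F)" by auto
    then obtain a b \<gamma> where g: "geodesic (graph_space U F) a b \<gamma>" "\<gamma> a = vertex x" "\<gamma> b = vertex y"
      using U.geodesic_space_realization unfolding geodesic_space_def by meson
    have ab: "a \<le> b" and gP: "\<And>t. t \<in> {a..b} \<Longrightarrow> \<gamma> t \<in> U.P"
      and gD: "\<And>s t. s \<in> {a..b} \<Longrightarrow> t \<in> {a..b} \<Longrightarrow> U.D (\<gamma> s) (\<gamma> t) = \<bar>s - t\<bar>"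
      using g(1) by (auto simp: geodesic_def)
    define N where "N = U.gd x y"
    have b: "b = a + real N" using gD[of a b] g(2,3) ab U.D_vertex[OF x y] by (simp add: N_def)
    \<comment> \<open>At \<open>k = 0\<close> and \<open>k = N\<close> the support is a singleton, so the endpoints are exactly \<open>x\<close> and \<open>y\<close>.\<close>
    define c where "c k = (SOME u. u \<in> supp (\<gamma> (a + real k)))" for k
    have at: "a + real k \<in> {a..b}" if "k \<le> N" for k using that b by simp
    have c: "c k \<in> supp (\<gamma> (a + real k))" if "k \<le> N" for k
      unfolding c_def using U.supp_nonempty[OF gP[OF at[OF that]]] by (simp add: some_in_eq)
    have cU: "c k \<in> U" if "k \<le> N" for k using c[OF that] U.supp_V[OF gP[OF at[OF that]]] by blast
    have c1: "U.D (\<gamma> (a + real k)) (vertex (c k)) \<le> 1" if "k \<le> N" for k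
      by (rule U.D_vertex_of_supp[OF gP[OF at[OF that]] c[OF that]])
    have ends: "c 0 = x" "c N = y" using c[of 0] c[of N] g(2,3) b by auto
    have img: "gd u v = D (\<Phi> (vertex u)) (\<Phi> (vertex v))" if "u \<in> U" "v \<in> U" for u v
      using D_vertex[of u v] vertex that subsetD[OF UV] by auto
    have "qpath K1 e1 x y N c"
      unfolding qpath_def
    proof (intro conjI allI impI)
      show "c 0 = x" "c N = y" by fact+
      show "c i \<in> V" if "i \<le> N" for i using cU[OF that] UV by blast
      fix i j assume "i \<le> j \<and> j \<le> N"
      then have ij: "i \<le> j" "j \<le> N" "i \<le> N" by auto
      let ?v = "\<lambda>k. vertex (c k)" and ?g = "\<lambda>k. \<gamma> (a + real k)"
      have W: "?v i \<in> U.P" "?v j \<in> U.P" "?g i \<in> U.P" "?g j \<in> U.P"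
        using cU ij gP at by auto
      have mid: "U.D (?g i) (?g j) = real (j - i)" using gD[OF at at] ij by (simp add: of_nat_diff)
      have near: "U.D (?g i) (?v i) \<le> 1" "U.D (?v i) (?g i) \<le> 1" "U.D (?g j) (?v j) \<le> 1"
          "U.D (?v j) (?g j) \<le> 1" using c1 ij U.D_commute by metis+
      have up: "U.D (?v i) (?v j) \<le> real (j - i) + 2"
        using near mid U.D_triangle[OF W(1,3,2)] U.D_triangle[OF W(3,4,2)] by linarith
      have lo: "real (j - i) \<le> U.D (?v i) (?v j) + 2"
        using near mid U.D_triangle[OF W(3,1,4)] U.D_triangle[OF W(1,2,4)] by linarith
      have g: "real (gd (c i) (c j)) = D (\<Phi> (?v i)) (\<Phi> (?v j))" using img cU ij by simp
      have "real (gd (c i) (c j)) \<le> K0 * U.D (?v i) (?v j) + \<epsilon>" using upper[OF W(1,2)] g by simp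
      also have "\<dots> \<le> K0 * (real (j - i) + 2) + \<epsilon>" using up K0 by simp
      also have "\<dots> = K0 * real (j - i) + (2 * K0 + \<epsilon>)" by (simp add: algebra_simps)
      also have "\<dots> \<le> real K1 * real (j - i) + real e1"
      proof (rule add_mono)
        show "K0 * real (j - i) \<le> real K1 * real (j - i)" using K1 by (intro mult_right_mono) auto
        have "0 \<le> K0 * \<epsilon>" using K0 by simp
        then show "2 * K0 + \<epsilon> \<le> real e1" using K1(2) by linarith
      qed
      also have "\<dots> = real (K1 * (j - i) + e1)" by simp
      finally show "gd (c i) (c j) \<le> K1 * (j - i) + e1" unfolding of_nat_le_iff .
      have "U.D (?v i) (?v j) / K0 \<le> real (gd (c i) (c j)) + \<epsilon>" using lower[OF W(1,2)] g by simp
      then have "U.D (?v i) (?v j) \<le> K0 * (real (gd (c i) (c j)) + \<epsilon>)"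
        using K0 by (simp add: pos_divide_le_eq mult.commute)
      then have "real (j - i) \<le> K0 * real (gd (c i) (c j)) + (K0 * \<epsilon> + 2)"
        using lo by (simp add: algebra_simps)
      also have "\<dots> \<le> real K1 * real (gd (c i) (c j)) + real e1"
      proof (rule add_mono)
        show "K0 * real (gd (c i) (c j)) \<le> real K1 * real (gd (c i) (c j))"
          using K1 by (intro mult_right_mono) auto
        show "K0 * \<epsilon> + 2 \<le> real e1" using K1(2) K0 by linarith
      qed
      also have "\<dots> = real (K1 * gd (c i) (c j) + e1)" by simp
      finally show "j - i \<le> K1 * gd (c i) (c j) + e1" unfolding of_nat_le_iff .
    qed
    moreover have "c ` {..N} \<subseteq> U" using cU by auto
    moreover have "near (c ` {..N}) (A K e) (p i)" if p: "qpath K e x y n p" and i: "i \<le> n" for K e n p i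
    proof -
      let ?\<eta> = "\<lambda>t. vertex (p (nat \<lfloor>t\<rfloor>))"
      have "?\<eta> 0 = (\<Phi> \<circ> \<gamma>) a" "?\<eta> (real n) = (\<Phi> \<circ> \<gamma>) b"
        using qpathD(1,2)[OF p] g vertex x y by auto
      then have "?\<eta> 0 \<in> (\<Phi> \<circ> \<gamma>) ` {a..b}" "?\<eta> (real n) \<in> (\<Phi> \<circ> \<gamma>) ` {a..b}"
        using ab by (metis atLeastAtMost_iff imageI order_refl)+
      moreover have "real i \<in> {0..real n}" using i by simp
      ultimately obtain s where s: "s \<in> {a..b}"
        "mdist (graph_space V E) (?\<eta> (real i)) ((\<Phi> \<circ> \<gamma>) s) \<le> f (real (K + 1)) (real (K + e + 1))"
        using f[OF g(1)] quasigeodesic_of_qpath[OF p] unfolding stable_quasigeodesic_def by blast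
      define k where "k = nat \<lfloor>s - a\<rfloor>"
      have k: "k \<le> N" "\<bar>s - (a + real k)\<bar> \<le> 1"
        using s(1) b unfolding k_def by (auto simp: nat_le_iff floor_le_iff) linarith+
      have W: "\<gamma> s \<in> U.P" "\<gamma> (a + real k) \<in> U.P" "vertex (c k) \<in> U.P"
        using gP s(1) at k(1) cU by auto
      have "U.D (\<gamma> s) (vertex (c k)) \<le> 2"
        using U.D_triangle[OF W] gD[OF s(1) at[OF k(1)]] c1[OF k(1)] k(2) by linarith
      then have "K0 * U.D (\<gamma> s) (vertex (c k)) \<le> K0 * 2" using K0 by (intro mult_left_mono) auto
      then have "D (\<Phi> (\<gamma> s)) (vertex (c k)) \<le> 2 * K0 + \<epsilon>"
        using upper[OF W(1,3)] vertex[OF cU[OF k(1)]] by simp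
      moreover have "D (vertex (p i)) (\<Phi> (\<gamma> s)) \<le> f (real (K + 1)) (real (K + e + 1))"
        using s(2) by simp
      moreover have "p i \<in> V" "c k \<in> V" using qpathD(5)[OF p i] cU[OF k(1)] UV by auto
      then have "real (gd (p i) (c k)) \<le> D (vertex (p i)) (\<Phi> (\<gamma> s)) + D (\<Phi> (\<gamma> s)) (vertex (c k))"
        using D_triangle[of "vertex (p i)" "\<Phi> (\<gamma> s)" "vertex (c k)"] D_vertex \<Phi>P[OF W(1)] by simp
      ultimately have "real (gd (p i) (c k)) \<le> real (A K e)" using A[of K e] by linarith
      then show ?thesis using k(1) unfolding near_def by auto
    qed
    ultimately show "\<exists>N c. qpath K1 e1 x y N c \<and> c ` {..N} \<subseteq> U \<and>
        (\<forall>K e n p. qpath K e x y n p \<longrightarrow> (\<forall>i\<le>n. near (c ` {..N}) (A K e) (p i)))" by blast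
  qed
qed

end

lemma thin_bigons_bilipschitz:
  assumes G: "connected_graph V E" and G': "connected_graph V E'"
    and c: "\<And>u v. u \<in> V \<Longrightarrow> v \<in> V \<Longrightarrow> graph_dist E u v \<le> c * graph_dist E' u v"
    and c': "\<And>u v. u \<in> V \<Longrightarrow> v \<in> V \<Longrightarrow> graph_dist E' u v \<le> c * graph_dist E u v"
    and Y: "Y \<subseteq> V" and thin: "connected_graph.thin_bigons V E B Y"
  shows "\<exists>B'. connected_graph.thin_bigons V E' B' Y"
proof -
  interpret X: connected_graph V E by fact
  interpret X': connected_graph V E' by fact
  have path: "X.qpath (K * c) (c * e + e) x y n p" if p: "X'.qpath K e x y n p" for K e x y n p
    unfolding X.qpath_def
  proof (intro conjI allI impI)
    fix i j assume "i \<le> j \<and> j \<le> n"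
    then have ij: "i \<le> j" "j \<le> n" by auto
    then have V: "p i \<in> V" "p j \<in> V" using X'.qpathD(5)[OF p] by auto
    have "j - i \<le> K * X'.gd (p i) (p j) + e" using X'.qpathD(6)[OF p ij] .
    also have "K * X'.gd (p i) (p j) \<le> K * (c * X.gd (p i) (p j))" using c'[OF V] by (rule mult_le_mono2)
    finally show "j - i \<le> K * c * X.gd (p i) (p j) + (c * e + e)" by (simp add: mult.assoc)
    have "X.gd (p i) (p j) \<le> c * (K * (j - i) + e)"
      using c[OF V] mult_le_mono2[OF X'.qpathD(7)[OF p ij], of c] by linarith
    then show "X.gd (p i) (p j) \<le> K * c * (j - i) + (c * e + e)" by (simp add: algebra_simps)
  qed (use X'.qpathD[OF p] in auto)
  have near: "X'.near Z (c * r) x" if x: "X.near Z r x" "Z \<subseteq> V" "x \<in> V" for Z r x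
  proof -
    obtain z where z: "z \<in> Z" "X.gd x z \<le> r" using x(1) unfolding X.near_def by blast
    then have "X'.gd x z \<le> c * X.gd x z" using c' x by blast
    also have "\<dots> \<le> c * r" using z(2) by simp
    finally show ?thesis using z(1) unfolding X'.near_def by blast
  qed
  let ?B = "\<lambda>K e. c * B (K * c) (c * e + e)"
  have "X'.thin_bigons ?B Y"
    unfolding X'.thin_bigons_def
  proof (intro allI impI)
    fix K e x y n p m q i
    assume h: "x \<in> Y \<and> y \<in> Y \<and> X'.qpath K e x y n p \<and> X'.qpath K e x y m q" and i: "i \<le> n"
    then have "X.near Y (B (K * c) (c * e + e)) (p i) \<and> X.near (q ` {..m}) (B (K * c) (c * e + e)) (p i)"
      using thin path unfolding X.thin_bigons_def by blast
    moreover have "p i \<in> V" "q ` {..m} \<subseteq> V" using X'.qpathD(5) h i by auto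
    ultimately show "X'.near Y (?B K e) (p i) \<and> X'.near (q ` {..m}) (?B K e) (p i)"
      using near Y by blast
  qed
  then show ?thesis by blast
qed

lemma (in connected_graph) thin_bigons_mono:
  assumes "thin_bigons B Y" "\<And>K e. B K e \<le> B' K e" shows "thin_bigons B' Y"
  using assms(1) unfolding thin_bigons_def by (meson near_mono assms(2))

lemma (in connected_graph) thin_bigons_uniform:
  assumes "finite \<H>" "\<And>H. H \<in> \<H> \<Longrightarrow> \<exists>B. thin_bigons B H"
  shows "\<exists>B. \<forall>H\<in>\<H>. thin_bigons B H"
proof -
  obtain B where B: "\<And>H. H \<in> \<H> \<Longrightarrow> thin_bigons (B H) H" using assms(2) by metis
  \<comment> \<open>The sum serves as an upper bound of the finitely many bounds.\<close>
  have "thin_bigons (\<lambda>K e. \<Sum>H\<in>\<H>. B H K e) H" if "H \<in> \<H>" for H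
    using B[OF that] by (rule thin_bigons_mono) (rule member_le_sum, use assms(1) that in auto)
  then show ?thesis by blast
qed

section \<open>Cayley graphs\<close>

locale cayley_graph = group G for G :: "('a, 'b) monoid_scheme" (structure) +
  fixes S :: "'a set"
  assumes generating: "finite_generating_set G S"

sublocale cayley_graph \<subseteq> connected_graph "carrier G" "cayley_edges G S"
  using generating connected_graph_cayley[OF group_axioms] unfolding finite_generating_set_def by blast

context cayley_graph
begin

lemma generators: "finite (S \<union> m_inv G ` S)" "S \<union> m_inv G ` S \<subseteq> carrier G"
  using generating unfolding finite_generating_set_def by auto

lemma path_translate:
  assumes "g \<in> carrier G" "a \<in> carrier G" "(a, b) \<in> cayley_edges G S ^^ n"
  shows "(g \<otimes> a, g \<otimes> b) \<in> cayley_edges G S ^^ n"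
  using assms(3)
proof (induction n arbitrary: b)
  case (Suc n)
  then obtain c where c: "(a, c) \<in> cayley_edges G S ^^ n" "(c, b) \<in> cayley_edges G S" by auto
  then obtain s where s: "c \<in> carrier G" "s \<in> S \<union> m_inv G ` S" "b = c \<otimes> s"
    unfolding cayley_edges_def by blast
  then have "g \<otimes> b = (g \<otimes> c) \<otimes> s" "g \<otimes> c \<in> carrier G" using assms generators(2) by (auto simp: m_assoc)
  then have "(g \<otimes> c, g \<otimes> b) \<in> cayley_edges G S" using s(2) unfolding cayley_edges_def by blast
  then show ?case using Suc.IH[OF c(1)] by auto
qed simp

lemma gd_translate:
  assumes "g \<in> carrier G" "a \<in> carrier G" "b \<in> carrier G"
  shows "gd (g \<otimes> a) (g \<otimes> b) = gd a b"
proof (rule antisym)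
  show le: "gd (g \<otimes> a) (g \<otimes> b) \<le> gd a b"
    by (rule gd_le, rule path_translate[OF assms(1,2) gd_path[OF assms(2,3)]])
  have "(inv g \<otimes> (g \<otimes> a), inv g \<otimes> (g \<otimes> b)) \<in> cayley_edges G S ^^ gd (g \<otimes> a) (g \<otimes> b)"
    by (rule path_translate, use assms in simp_all, rule gd_path) (use assms in simp_all)
  then show "gd a b \<le> gd (g \<otimes> a) (g \<otimes> b)" using gd_le assms by (simp flip: m_assoc)
qed

lemma finite_ball:
  assumes "a \<in> carrier G" shows "finite {b \<in> carrier G. gd a b \<le> n}"
proof -
  have sphere: "finite {b. (a, b) \<in> cayley_edges G S ^^ k}" for k
  proof (induction k)
    case (Suc k)
    have "{b. (a, b) \<in> cayley_edges G S ^^ Suc k} \<subseteq>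
        (\<lambda>(c, s). c \<otimes> s) ` ({b. (a, b) \<in> cayley_edges G S ^^ k} \<times> (S \<union> m_inv G ` S))"
      unfolding cayley_edges_def by auto
    moreover have "finite \<dots>" using Suc generators(1) by blast
    ultimately show ?case by (rule finite_subset)
  qed simp
  have "{b \<in> carrier G. gd a b \<le> n} \<subseteq> (\<Union>k\<le>n. {b. (a, b) \<in> cayley_edges G S ^^ k})"
    using gd_path[OF assms] by blast
  then show ?thesis by (rule finite_subset) (use sphere in blast)
qed

text \<open>Every edge of one Cayley graph joins points at bounded distance in the other one, by homogeneity and
since there are finitely many generators.\<close>

lemma gd_lipschitz:
  assumes "cayley_graph G T"
  shows "\<exists>c. \<forall>a\<in>carrier G. \<forall>b\<in>carrier G. gd a b \<le> c * graph_dist (cayley_edges G T) a b"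
proof -
  interpret T: cayley_graph G T by fact
  define c where "c = (\<Sum>t\<in>T \<union> m_inv G ` T. gd \<one> t)"
  have edge: "gd a (a \<otimes> t) \<le> c" if "a \<in> carrier G" "t \<in> T \<union> m_inv G ` T" for a t
  proof -
    have "gd a (a \<otimes> t) = gd \<one> t" using gd_translate[of a \<one> t] that T.generators(2) by auto
    also have "\<dots> \<le> c" unfolding c_def by (rule member_le_sum) (use that T.generators(1) in auto)
    finally show ?thesis .
  qed
  have path: "b \<in> carrier G \<and> gd a b \<le> c * n" if "a \<in> carrier G" "(a, b) \<in> cayley_edges G T ^^ n" for a b n
    using that(2)
  proof (induction n arbitrary: b)
    case 0
    then show ?case using that(1) by simp
  next
    case (Suc n)
    then obtain d where d: "(a, d) \<in> cayley_edges G T ^^ n" "(d, b) \<in> cayley_edges G T" by auto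
    then obtain t where t: "d \<in> carrier G" "t \<in> T \<union> m_inv G ` T" "b = d \<otimes> t"
      unfolding cayley_edges_def by blast
    then have b: "b \<in> carrier G" using T.generators(2) by auto
    have "gd a b \<le> gd a d + gd d b" using gd_triangle that(1) t(1) b by blast
    then show ?case using Suc.IH[OF d(1)] edge[OF t(1,2)] t(3) b by simp
  qed
  show ?thesis using path T.gd_path by blast
qed

lemma thin_bigons_change_generators:
  assumes "cayley_graph G T" "Y \<subseteq> carrier G"
    and "connected_graph.thin_bigons (carrier G) (cayley_edges G T) B Y"
  shows "\<exists>B'. thin_bigons B' Y"
proof -
  interpret T: cayley_graph G T by fact
  obtain c where c: "\<And>a b. a \<in> carrier G \<Longrightarrow> b \<in> carrier G \<Longrightarrow> gd a b \<le> c * T.gd a b"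
    using gd_lipschitz[OF assms(1)] by blast
  obtain c' where c': "\<And>a b. a \<in> carrier G \<Longrightarrow> b \<in> carrier G \<Longrightarrow> T.gd a b \<le> c' * gd a b"
    using T.gd_lipschitz[of S] cayley_graph_axioms by blast
  show ?thesis
  proof (rule thin_bigons_bilipschitz[OF T.connected_graph_axioms connected_graph_axioms _ _ assms(2,3)])
    fix a b assume ab: "a \<in> carrier G" "b \<in> carrier G"
    show "T.gd a b \<le> (c + c') * gd a b" using c'[OF ab] by (simp add: distrib_right)
    show "gd a b \<le> (c + c') * T.gd a b" using c[OF ab] by (simp add: distrib_right)
  qed
qed

lemma qpath_translate:
  assumes g: "g \<in> carrier G" and p: "qpath K e x y n p"
  shows "qpath K e (g \<otimes> x) (g \<otimes> y) n (\<lambda>k. g \<otimes> p k)"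
  unfolding qpath_def
proof (intro conjI allI impI)
  fix i j assume "i \<le> j \<and> j \<le> n"
  then have ij: "i \<le> j" "j \<le> n" "p i \<in> carrier G" "p j \<in> carrier G" using qpathD(5)[OF p] by auto
  then show "j - i \<le> K * gd (g \<otimes> p i) (g \<otimes> p j) + e" "gd (g \<otimes> p i) (g \<otimes> p j) \<le> K * (j - i) + e"
    using qpathD(6,7)[OF p ij(1,2)] gd_translate[OF g] by auto
qed (use qpathD[OF p] g in auto)

lemma thin_bigons_coset:
  assumes H: "H \<subseteq> carrier G" "thin_bigons B H" and g: "g \<in> carrier G"
  shows "thin_bigons B (g <# H)"
  unfolding thin_bigons_def
proof (intro allI impI)
  fix K e x y n p m q i
  assume h: "x \<in> g <# H \<and> y \<in> g <# H \<and> qpath K e x y n p \<and> qpath K e x y m q" and i: "i \<le> n"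
  then obtain u v where uv: "u \<in> H" "x = g \<otimes> u" "v \<in> H" "y = g \<otimes> v" unfolding l_coset_def by blast
  then have UV: "u \<in> carrier G" "v \<in> carrier G" using H by auto
  let ?t = "\<lambda>r k. inv g \<otimes> r k"
  have "qpath K e u v n (?t p)" "qpath K e u v m (?t q)"
    using qpath_translate[of "inv g" K e x y] h g uv UV by (auto simp flip: m_assoc)
  then have thin: "near H (B K e) (?t p i)" "near (?t q ` {..m}) (B K e) (?t p i)"
    using H(2) uv i unfolding thin_bigons_def by blast+
  have V: "p i \<in> carrier G" "\<And>j. j \<le> m \<Longrightarrow> q j \<in> carrier G" using qpathD(5) h i by auto
  obtain w where w: "w \<in> H" "gd (?t p i) w \<le> B K e" using thin(1) unfolding near_def by blast
  then have "gd (p i) (g \<otimes> w) \<le> B K e"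
    using gd_translate[of g "?t p i" w] V g H(1) by (auto simp flip: m_assoc)
  then have "near (g <# H) (B K e) (p i)" using w(1) unfolding near_def l_coset_def by blast
  moreover obtain j where j: "j \<le> m" "gd (?t p i) (?t q j) \<le> B K e"
    using thin(2) unfolding near_def by auto
  then have "gd (p i) (q j) \<le> B K e" using gd_translate[of "inv g" "p i" "q j"] V g by simp
  then have "near (q ` {..m}) (B K e) (p i)" using j(1) unfolding near_def by blast
  ultimately show "near (g <# H) (B K e) (p i) \<and> near (q ` {..m}) (B K e) (p i)" by blast
qed

text \<open>The generating set of \<open>G\<close> in the definition of stability depends on \<open>H\<close>; the property is transferred from
there to the fixed set \<open>S\<close>, so that several subgroups can be compared in one Cayley graph.\<close>

lemma stable_subgroup_thin_bigons:
  assumes "stable_subgroup G H" shows "\<exists>B. thin_bigons B H"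
proof -
  obtain S' T \<Phi> where st: "subgroup H G" "finite_generating_set G S'"
    "finite_generating_set (G\<lparr>carrier := H\<rparr>) T" "\<And>h. h \<in> H \<Longrightarrow> \<Phi> (vertex h) = vertex h"
    "stable_embedding (cayley_space (G\<lparr>carrier := H\<rparr>) T) (cayley_space G S') \<Phi>"
    using assms unfolding stable_subgroup_def by blast
  have H: "group (G\<lparr>carrier := H\<rparr>)" using st(1) by (rule subgroup.subgroup_is_group) (rule group_axioms)
  interpret S': cayley_graph G S' by unfold_locales (rule st(2))
  interpret H: cayley_graph "G\<lparr>carrier := H\<rparr>" T
    using H st(3) by (simp add: cayley_graph_def cayley_graph_axioms_def)
  have HG: "H \<subseteq> carrier G" using st(1) by (rule subgroup.subset)
  have "connected_graph H (cayley_edges (G\<lparr>carrier := H\<rparr>) T)" using H.connected_graph_axioms by simp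
  then obtain B where "S'.thin_bigons B H"
    using S'.stable_embedding_thin_bigons[OF _ HG st(4)] st(5) unfolding cayley_space_def by auto
  then show ?thesis using thin_bigons_change_generators[OF S'.cayley_graph_axioms HG] by blast
qed

end

section \<open>Cosets of finitely many stable subgroups\<close>

locale stable_collection = cayley_graph G S for G :: "('a, 'b) monoid_scheme" (structure) and S +
  fixes \<H> :: "'a set set"
  assumes finite_collection: "finite \<H>" and stable: "H \<in> \<H> \<Longrightarrow> stable_subgroup G H"
begin

abbreviation "cosets \<equiv> {g <# H | g H. g \<in> carrier G \<and> H \<in> \<H>}"

lemma subgroup: "H \<in> \<H> \<Longrightarrow> subgroup H G"
  using stable unfolding stable_subgroup_def by blast

lemma cosets_thin_family: "\<exists>B. thin_family (carrier G) (cayley_edges G S) cosets B"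
proof -
  obtain B where B: "\<And>H. H \<in> \<H> \<Longrightarrow> thin_bigons B H"
    using thin_bigons_uniform[OF finite_collection] stable_subgroup_thin_bigons stable by metis
  have HG: "H \<subseteq> carrier G" if "H \<in> \<H>" for H using subgroup[OF that] by (rule subgroup.subset)
  have "thin_family (carrier G) (cayley_edges G S) cosets B"
  proof
    fix Y assume "Y \<in> cosets"
    then obtain g H where gH: "g \<in> carrier G" "H \<in> \<H>" "Y = g <# H" by blast
    show "Y \<subseteq> carrier G" using l_coset_subset_G[OF HG[OF gH(2)] gH(1)] gH(3) by simp
    show "thin_bigons B Y" using thin_bigons_coset[OF HG[OF gH(2)] B[OF gH(2)] gH(1)] gH(3) by simp
  qed
  then show ?thesis by blast
qed

text \<open>Every coset in such a collection \<open>\<C>\<close> meets the ball of radius \<open>R\<close> about one common point \<open>x\<close>, and a coset of a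
member of \<open>\<H>\<close> is determined by any of its points together with the member. Hence there are at
most as many cosets as pairs of an element of the ball and a member.\<close>

lemma close_cosets_bounded:
  "\<exists>N. \<forall>\<C>. finite \<C> \<and> \<C> \<subseteq> cosets \<and> (\<forall>Y\<in>\<C>. \<forall>Z\<in>\<C>. \<exists>y\<in>Y. near Z d y) \<longrightarrow> card \<C> \<le> N"
proof -
  obtain B where "thin_family (carrier G) (cayley_edges G S) cosets B"
    using cosets_thin_family by blast
  then interpret F: thin_family "carrier G" "cayley_edges G S" cosets B .
  obtain R where R: "\<And>\<C>. finite \<C> \<Longrightarrow> \<C> \<subseteq> cosets \<Longrightarrow> \<C> \<noteq> {} \<Longrightarrow>
      (\<And>Y Z. Y \<in> \<C> \<Longrightarrow> Z \<in> \<C> \<Longrightarrow> \<exists>y\<in>Y. near Z d y) \<Longrightarrow> \<exists>x\<in>carrier G. \<forall>Z\<in>\<C>. near Z R x"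
    using F.coarse_helly[of d] by (elim exE) (metis (no_types, lifting))
  define U where "U = {w \<in> carrier G. gd \<one> w \<le> R} \<times> \<H>"
  have U: "finite U" unfolding U_def using finite_ball finite_collection by blast
  have "card \<C> \<le> card U"
    if C: "finite \<C>" "\<C> \<subseteq> cosets" and close: "\<And>Y Z. Y \<in> \<C> \<Longrightarrow> Z \<in> \<C> \<Longrightarrow> \<exists>y\<in>Y. near Z d y" for \<C>
  proof (cases "\<C> = {}")
    case False
    then obtain x where x: "x \<in> carrier G" "\<And>Z. Z \<in> \<C> \<Longrightarrow> near Z R x"
      using R[OF C False] close by blast
    have "\<C> \<subseteq> (\<lambda>(w, H). (x \<otimes> w) <# H) ` U"
    proof
      fix Z assume Z: "Z \<in> \<C>"
      then obtain g H where gH: "g \<in> carrier G" "H \<in> \<H>" "Z = g <# H" using C(2) by blast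
      obtain z where z: "z \<in> Z" "gd x z \<le> R" using x(2)[OF Z] unfolding near_def by blast
      have HG: "subgroup H G" using subgroup gH by blast
      have zG: "z \<in> carrier G" using z(1) gH l_coset_subset_G subgroup.subset[OF HG] by blast
      define w where "w = inv x \<otimes> z"
      have w: "w \<in> carrier G" "x \<otimes> w = z" using x(1) zG by (auto simp: w_def simp flip: m_assoc)
      have "gd \<one> w \<le> R" using gd_translate[of x \<one> w] x(1) w z(2) by simp
      moreover have "(x \<otimes> w) <# H = Z" using w(2) z(1) gH l_repr_independence[OF _ gH(1) HG] by simp
      ultimately show "Z \<in> (\<lambda>(w, H). (x \<otimes> w) <# H) ` U"
        unfolding U_def using w(1) gH(2) by force
    qed
    then show ?thesis using U by (meson card_image_le card_mono finite_imageI order_trans)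
  qed simp
  then show ?thesis by (intro exI[of _ "card U"] allI impI) (elim conjE, simp)
qed

lemma conjugateD:
  assumes "g \<in> carrier G" "H \<in> \<H>" "z \<in> conjugate G H g"
  shows "z \<in> carrier G" "z \<otimes> g \<in> g <# H"
proof -
  have HG: "H \<subseteq> carrier G" using subgroup[OF assms(2)] by (rule subgroup.subset)
  obtain h where h: "h \<in> H" "z = g \<otimes> h \<otimes> inv g"
    using assms(3) unfolding conjugate_def l_coset_def r_coset_def by blast
  then have hG: "h \<in> carrier G" using HG by blast
  show "z \<in> carrier G" using h assms(1) hG by simp
  have "z \<otimes> g = g \<otimes> h" using h assms(1) hG by (simp add: m_assoc)
  then show "z \<otimes> g \<in> g <# H" using h(1) unfolding l_coset_def by blast
qed

text \<open>Left multiplication by an element \<open>z\<close> of the intersection maps \<open>g\<close> and \<open>g'\<close> to points of their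
cosets without changing their distance. Balls are finite, so some \<open>z\<close> moves \<open>g\<close> far enough for the two
cosets to count as parallel.\<close>

lemma infinite_intersection_close:
  "\<exists>d. \<forall>g g' H H'. g \<in> carrier G \<and> g' \<in> carrier G \<and> H \<in> \<H> \<and> H' \<in> \<H> \<and>
     infinite (conjugate G H g \<inter> conjugate G H' g') \<longrightarrow> (\<exists>y\<in>g <# H. near (g' <# H') d y)"
proof -
  obtain B where "thin_family (carrier G) (cayley_edges G S) cosets B"
    using cosets_thin_family by blast
  then interpret F: thin_family "carrier G" "cayley_edges G S" cosets B .
  have "\<exists>y\<in>g <# H. near (g' <# H') (2 * F.fellow 1 0 0 + F.fellow 3 0 (F.fellow 1 0 0)) y"
    if g: "g \<in> carrier G" "g' \<in> carrier G" and H: "H \<in> \<H>" "H' \<in> \<H>"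
      and inf: "infinite (conjugate G H g \<inter> conjugate G H' g')" for g g' H H'
  proof -
    let ?I = "conjugate G H g \<inter> conjugate G H' g'" and ?d = "gd g g'"
    have I: "z \<in> carrier G" "z \<otimes> g \<in> g <# H" "z \<otimes> g' \<in> g' <# H'" if "z \<in> ?I" for z
      using conjugateD[OF g(1) H(1)] conjugateD[OF g(2) H(2)] that by auto
    have "\<exists>z\<in>?I. 12 * ?d \<le> gd g (z \<otimes> g)"
    proof (rule ccontr)
      assume "\<not> ?thesis"
      then have "(\<lambda>z. z \<otimes> g) ` ?I \<subseteq> {b \<in> carrier G. gd g b \<le> 12 * ?d}"
        using I(1) g(1) by (force simp: not_le)
      then have "finite ((\<lambda>z. z \<otimes> g) ` ?I)" using finite_ball[OF g(1)] finite_subset by blast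
      moreover have "inj_on (\<lambda>z. z \<otimes> g) ?I" using I(1) g(1) by (intro inj_onI) (simp add: right_cancel)
      ultimately show False using inf finite_imageD by blast
    qed
    then obtain z where z: "z \<in> ?I" "12 * ?d \<le> gd g (z \<otimes> g)" by blast
    have "\<one> \<in> H" "\<one> \<in> H'" using subgroup H subgroup.one_closed by auto
    then have "g \<in> g <# H" "g' \<in> g' <# H'" using g unfolding l_coset_def by force+
    moreover have "gd (z \<otimes> g) (z \<otimes> g') \<le> ?d" using gd_translate I(1)[OF z(1)] g by simp
    moreover have "g <# H \<in> cosets" "g' <# H' \<in> cosets" using g H by auto
    ultimately show ?thesis using F.parallel_close[OF _ _ _ I(2)[OF z(1)] _ I(3)[OF z(1)] _ _ z(2)] by blast
  qed
  then show ?thesis by blast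
qed

lemma infinite_intersections_bounded:
  "\<exists>N. \<forall>k g K. distinct_cosets G \<H> k g K \<and>
     (\<forall>i<k. \<forall>j<k. i \<noteq> j \<longrightarrow> infinite (conjugate G (K i) (g i) \<inter> conjugate G (K j) (g j))) \<longrightarrow> k \<le> N"
proof -
  obtain d where d: "\<And>g g' H H'. g \<in> carrier G \<Longrightarrow> g' \<in> carrier G \<Longrightarrow> H \<in> \<H> \<Longrightarrow> H' \<in> \<H> \<Longrightarrow>
     infinite (conjugate G H g \<inter> conjugate G H' g') \<Longrightarrow> \<exists>y\<in>g <# H. near (g' <# H') d y"
    using infinite_intersection_close by (elim exE) blast
  obtain N where N: "\<And>\<C>. finite \<C> \<Longrightarrow> \<C> \<subseteq> cosets \<Longrightarrow>
      (\<And>Y Z. Y \<in> \<C> \<Longrightarrow> Z \<in> \<C> \<Longrightarrow> \<exists>y\<in>Y. near Z d y) \<Longrightarrow> card \<C> \<le> N"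
    using close_cosets_bounded[of d] by (elim exE) (metis (no_types, lifting))
  have "k \<le> N" if dist: "distinct_cosets G \<H> k g K"
    and inf: "\<And>i j. i < k \<Longrightarrow> j < k \<Longrightarrow> i \<noteq> j \<Longrightarrow>
      infinite (conjugate G (K i) (g i) \<inter> conjugate G (K j) (g j))" for k g K
  proof -
    let ?c = "\<lambda>i. g i <# K i"
    have gK: "g i \<in> carrier G" "K i \<in> \<H>" if "i < k" for i
      using dist that unfolding distinct_cosets_def by auto
    have "\<exists>y\<in>?c i. near (?c j) d y" if ij: "i < k" "j < k" for i j
    proof (cases "i = j")
      case True
      have "\<one> \<in> K i" using subgroup gK(2)[OF ij(1)] subgroup.one_closed by blast
      then have "g i \<in> ?c i" using gK[OF ij(1)] unfolding l_coset_def by force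
      then show ?thesis using True unfolding near_def by force
    next
      case False
      then show ?thesis using d[OF gK(1)[OF ij(1)] gK(1)[OF ij(2)] gK(2)[OF ij(1)] gK(2)[OF ij(2)]] inf ij by simp
    qed
    moreover have "?c ` {..<k} \<subseteq> cosets" using gK by blast
    ultimately have "card (?c ` {..<k}) \<le> N" by (intro N) auto
    moreover have "card (?c ` {..<k}) = k"
      using dist unfolding distinct_cosets_def by (simp add: card_image)
    ultimately show ?thesis by simp
  qed
  then show ?thesis by (intro exI[of _ N] allI impI) (elim conjE, simp)
qed

theorem finite_height: "finite_height G \<H>"
proof -
  obtain N where N: "\<And>k g K. distinct_cosets G \<H> k g K \<Longrightarrow>
     (\<And>i j. i < k \<Longrightarrow> j < k \<Longrightarrow> i \<noteq> j \<Longrightarrow> infinite (conjugate G (K i) (g i) \<inter> conjugate G (K j) (g j))) \<Longrightarrow>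
     k \<le> N"
    using infinite_intersections_bounded by (elim exE) (metis (no_types, lifting))
  have "finite (\<Inter>i<N + 1. conjugate G (K i) (g i))" if "distinct_cosets G \<H> (N + 1) g K" for g K
  proof (rule ccontr)
    assume inf: "infinite (\<Inter>i<N + 1. conjugate G (K i) (g i))"
    have "infinite (conjugate G (K i) (g i) \<inter> conjugate G (K j) (g j))" if "i < N + 1" "j < N + 1" for i j
      by (rule infinite_super[OF _ inf]) (use that in blast)
    then have "N + 1 \<le> N" using N that by blast
    then show False by simp
  qed
  then show ?thesis unfolding finite_height_def height_at_most_def by blast
qed

theorem finite_width: "finite_width G \<H>"
proof -
  obtain N where N: "\<And>k g K. distinct_cosets G \<H> k g K \<Longrightarrow>
     (\<And>i j. i < k \<Longrightarrow> j < k \<Longrightarrow> i \<noteq> j \<Longrightarrow> infinite (conjugate G (K i) (g i) \<inter> conjugate G (K j) (g j))) \<Longrightarrow>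
     k \<le> N"
    using infinite_intersections_bounded by (elim exE) (metis (no_types, lifting))
  have "width G \<H> \<le> enat N" unfolding width_def by (rule Sup_least) (use N in force)
  also have "\<dots> < \<infinity>" by simp
  finally show ?thesis unfolding finite_width_def .
qed

end

theorem theorem1p1:
  fixes G :: "('a, 'b) monoid_scheme" and H :: "nat \<Rightarrow> 'a set" and l :: nat
  assumes "group G" and "finitely_generated G"
    and "\<And>i. i \<in> {1..l} \<Longrightarrow> stable_subgroup G (H i)"
  shows "finite_height G (H ` {1..l}) \<and>
         finite_width G (H ` {1..l}) \<and>
         bounded_packing G (H ` {1..l})"
proof (intro conjI)
  have collection: "stable_collection G S (H ` {1..l})" if "finite_generating_set G S" for S
    using assms that unfolding stable_collection_def stable_collection_axioms_def
      cayley_graph_def cayley_graph_axioms_def by auto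
  obtain S where "finite_generating_set G S" using assms(2) unfolding finitely_generated_def by blast
  then show "finite_height G (H ` {1..l})" "finite_width G (H ` {1..l})"
    using collection stable_collection.finite_height stable_collection.finite_width by blast+
  show "bounded_packing G (H ` {1..l})"
    unfolding bounded_packing_def
  proof (intro allI impI)
    fix S and D :: real
    assume "finite_generating_set G S" and D: "0 \<le> D"
    then interpret stable_collection G S "H ` {1..l}" by (intro collection)
    obtain N where N: "\<And>\<C>. finite \<C> \<Longrightarrow> \<C> \<subseteq> cosets \<Longrightarrow>
        (\<And>Y Z. Y \<in> \<C> \<Longrightarrow> Z \<in> \<C> \<Longrightarrow> \<exists>y\<in>Y. near Z (nat \<lceil>D\<rceil>) y) \<Longrightarrow> card \<C> \<le> N"
      using close_cosets_bounded[of "nat \<lceil>D\<rceil>"] by (elim exE) (metis (no_types, lifting))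
    have "\<exists>A\<in>\<C>. \<exists>B\<in>\<C>. A \<noteq> B \<and> (\<forall>a\<in>A. \<forall>b\<in>B. D \<le> real (word_metric G S a b))"
      if C: "\<C> \<subseteq> cosets" "card \<C> = N + 1" for \<C>
    proof (rule ccontr)
      assume none: "\<not> ?thesis"
      have "\<exists>y\<in>Y. near Z (nat \<lceil>D\<rceil>) y" if YZ: "Y \<in> \<C>" "Z \<in> \<C>" for Y Z
      proof (cases "Y = Z")
        case True
        obtain g K where gK: "g \<in> carrier G" "K \<in> H ` {1..l}" "Y = g <#\<^bsub>G\<^esub> K" using C(1) YZ(1) by blast
        have "\<one>\<^bsub>G\<^esub> \<in> K" using subgroup gK(2) subgroup.one_closed by blast
        then have "g \<in> Y" using gK(1,3) unfolding l_coset_def by force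
        then show ?thesis using True unfolding near_def by force
      next
        case False
        then obtain y z where yz: "y \<in> Y" "z \<in> Z" "real (word_metric G S y z) < D"
          using none YZ by (meson not_le)
        then have "gd y z \<le> nat \<lceil>D\<rceil>" unfolding word_metric_def by linarith
        then show ?thesis using yz(1,2) unfolding near_def by blast
      qed
      moreover have "finite \<C>" using C(2) card.infinite by fastforce
      ultimately have "card \<C> \<le> N" using N C(1) by blast
      then show False using C(2) by simp
    qed
    then show "\<exists>N. \<forall>\<C>. \<C> \<subseteq> cosets \<and> card \<C> = N \<longrightarrow>
        (\<exists>A\<in>\<C>. \<exists>B\<in>\<C>. A \<noteq> B \<and> (\<forall>a\<in>A. \<forall>b\<in>B. D \<le> real (word_metric G S a b)))"
      by blast
  qed
qed

end
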